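(* Let $\mathbf{C}$ be a representable Markov category with associated monad $(P,\mu,\delta)$ on $\mathbf{C}_{\mathrm{det}}$. Suppose moreover that $\mathbf{C}$ has conditionals and that $\mathbf{C}$ satisfies the equalizer principle. Then the functor $P:\mathbf{C}_{\mathrm{det}}\to\mathbf{C}_{\mathrm{det}}$ preserves weak pullbacks.
   Context: A Markov category is a symmetric monoidal category $(\mathbf{C},\otimes,I)$ (coherence isomorphisms suppressed) in which every object $X$ carries a distinguished commutative comonoid structure $\mathrm{copy}_X:X\to X\otimes X$, $\mathrm{del}_X:X\to I$, compatible with the tensor product, and such that $\mathrm{del}_Y\circ f=\mathrm{del}_X$ for every $f:X\to Y$ (equivalently, $I$ is terminal). A morphism $f:A\to X$ is deterministic if $\mathrm{copy}_X\circ f=(f\otimes f)\circ\mathrm{copy}_A$; $\mathbf{C}_{\mathrm{det}}$ is the subcategory of all objects and deterministic morphisms. Conditionals: a conditional of $f:A\to X\otimes Y$ with respect to $X$ is a morphism $f|_X:X\otimes A\to Y$ with $f=(\mathrm{id}_X\otimes f|_X)\circ(\mathrm{copy}_X\otimes \mathrm{id}_A)\circ(f_X\otimes \mathrm{id}_A)\circ\mathrm{copy}_A$, where $f_X=(\mathrm{id}_X\otimes\mathrm{del}_Y)\circ f$. $\mathbf{C}$ has conditionals if every morphism admits a conditional with respect to any of its outputs. Almost sure equality: for $p:A\to X$ and $f,g:X\to Y$, write $f=_{p}g$ if $(\mathrm{id}_X\otimes f)\circ\mathrm{copy}_X\circ p=(\mathrm{id}_X\otimes g)\circ\mathrm{copy}_X\circ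 p$. Equalizer principle: (i) equalizers in $\mathbf{C}_{\mathrm{det}}$ exist; (ii) for every equalizer $\mathrm{eq}:E\to X$ in $\mathbf{C}_{\mathrm{det}}$ of deterministic $f,g:X\to Y$, every $p:A\to X$ in $\mathbf{C}$ with $f=_p g$ factors uniquely across $\mathrm{eq}$, i.e. there is a unique $r:A\to E$ in $\mathbf{C}$ with $\mathrm{eq}\circ r=p$. Representability: a distribution object for $X$ is an object $PX$ with a morphism $\mathrm{samp}_X:PX\to X$ such that $\mathrm{samp}_X\circ-:\mathbf{C}_{\mathrm{det}}(A,PX)\to\mathbf{C}(A,X)$ is a bijection for every $A$; its inverse is denoted $f\mapsto f^\#$, and $\delta_X:=(1_X)^\#:X\to PX$. $\mathbf{C}$ is representable if every object has a distribution object. Then $P$ becomes a functor $\mathbf{C}\to\mathbf{C}_{\mathrm{det}}$, $Pf=(f\circ\mathrm{samp}_X)^\#$ for $f:X\to Y$, right adjoint to the inclusion $\mathbf{C}_{\mathrm{det}}\hookrightarrow\mathbf{C}$ with unit $\delta$ and counit $\mathrm{samp}$; the associated monad on $\mathbf{C}_{\mathrm{det}}$ is $(P,\mu,\delta)$ with $\mu_X=P(\mathrm{samp}_X)$. Weak pullback: a commutative square $m\circ f=n\circ g$ (with $f:A\to B$, $g:A\to C$, $m:B\to D$, $n:C\to D$) is a weak pullback if for every object $S$ and all $q:S\to B$, $p:S\to C$ with $m\circ q=n\circ p$ there is a (not necessarily unique) $r:S\to A$ with $f\circ r=q$ and $g\circ r=p$. A functor preserves weak pullbacks if it sends every weak pullback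 square to a weak pullback square. *)

theory Defs
  imports Main
begin

section \<open>Categories\<close>

record ('o, 'm) cat_data =
  Obj :: "'o set"
  Arr :: "'m set"
  Dom :: "'m \<Rightarrow> 'o"
  Cod :: "'m \<Rightarrow> 'o"
  Id :: "'o \<Rightarrow> 'm" ("\<one>\<index>")
  Comp :: "'m \<Rightarrow> 'm \<Rightarrow> 'm" (infixr "\<cdot>\<index>" 55)

definition Hom :: "('o, 'm, 'x) cat_data_scheme \<Rightarrow> 'o \<Rightarrow> 'o \<Rightarrow> 'm set" where
  "Hom C A B = {f \<in> Arr C. Dom C f = A \<and> Cod C f = B}"

locale category =
  fixes C :: "('o, 'm, 'x) cat_data_scheme" (structure)
  assumes Dom_in_Obj: "f \<in> Arr C \<Longrightarrow> Dom C f \<in> Obj C"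
    and Cod_in_Obj: "f \<in> Arr C \<Longrightarrow> Cod C f \<in> Obj C"
    and Id_in_Hom: "A \<in> Obj C \<Longrightarrow> \<one> A \<in> Hom C A A"
    and Comp_in_Hom: "\<lbrakk>f \<in> Hom C A B; g \<in> Hom C B D\<rbrakk> \<Longrightarrow> g \<cdot> f \<in> Hom C A D"
    and Comp_Id_right: "f \<in> Hom C A B \<Longrightarrow> f \<cdot> \<one> A = f"
    and Comp_Id_left: "f \<in> Hom C A B \<Longrightarrow> \<one> B \<cdot> f = f"
    and Comp_assoc: "\<lbrakk>f \<in> Hom C A B; g \<in> Hom C B D; h \<in> Hom C D E\<rbrakk>
      \<Longrightarrow> (h \<cdot> g) \<cdot> f = h \<cdot> (g \<cdot> f)"

locale cat_functor = source: category C + target: category D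
  for C :: "('o, 'm, 'x) cat_data_scheme" and D :: "('p, 'n, 'y) cat_data_scheme" +
  fixes F0 :: "'o \<Rightarrow> 'p" and F1 :: "'m \<Rightarrow> 'n"
  assumes maps_Obj: "A \<in> Obj C \<Longrightarrow> F0 A \<in> Obj D"
    and maps_Hom: "f \<in> Hom C A B \<Longrightarrow> F1 f \<in> Hom D (F0 A) (F0 B)"
    and maps_Id: "A \<in> Obj C \<Longrightarrow> F1 (\<one>\<^bsub>C\<^esub> A) = \<one>\<^bsub>D\<^esub> (F0 A)"
    and maps_Comp: "\<lbrakk>f \<in> Hom C A B; g \<in> Hom C B E\<rbrakk>
      \<Longrightarrow> F1 (g \<cdot>\<^bsub>C\<^esub> f) = F1 g \<cdot>\<^bsub>D\<^esub> F1 f"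

definition inverse_arrows :: "('o, 'm, 'x) cat_data_scheme \<Rightarrow> 'm \<Rightarrow> 'm \<Rightarrow> bool" where
  "inverse_arrows C f g \<longleftrightarrow>
     f \<in> Hom C (Dom C f) (Cod C f) \<and> g \<in> Hom C (Cod C f) (Dom C f) \<and>
     g \<cdot>\<^bsub>C\<^esub> f = \<one>\<^bsub>C\<^esub> (Dom C f) \<and> f \<cdot>\<^bsub>C\<^esub> g = \<one>\<^bsub>C\<^esub> (Cod C f)"

definition is_iso :: "('o, 'm, 'x) cat_data_scheme \<Rightarrow> 'm \<Rightarrow> bool" where
  "is_iso C f \<longleftrightarrow> (\<exists>g. inverse_arrows C f g)"

definition inv_arr :: "('o, 'm, 'x) cat_data_scheme \<Rightarrow> 'm \<Rightarrow> 'm" where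
  "inv_arr C f = (THE g. inverse_arrows C f g)"

definition is_equalizer :: "('o, 'm, 'x) cat_data_scheme \<Rightarrow> 'm \<Rightarrow> 'm \<Rightarrow> 'm \<Rightarrow> bool" where
  "is_equalizer C f g e \<longleftrightarrow>
     (\<exists>E X Y. f \<in> Hom C X Y \<and> g \<in> Hom C X Y \<and> e \<in> Hom C E X \<and>
        f \<cdot>\<^bsub>C\<^esub> e = g \<cdot>\<^bsub>C\<^esub> e \<and>
        (\<forall>A \<in> Obj C. \<forall>h \<in> Hom C A X. f \<cdot>\<^bsub>C\<^esub> h = g \<cdot>\<^bsub>C\<^esub> h \<longrightarrow>
           (\<exists>!u. u \<in> Hom C A E \<and> e \<cdot>\<^bsub>C\<^esub> u = h)))"

definition has_equalizers :: "('o, 'm, 'x) cat_data_scheme \<Rightarrow> bool" where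
  "has_equalizers C \<longleftrightarrow>
     (\<forall>X \<in> Obj C. \<forall>Y \<in> Obj C. \<forall>f \<in> Hom C X Y. \<forall>g \<in> Hom C X Y. \<exists>e. is_equalizer C f g e)"

definition weak_pullback ::
    "('o, 'm, 'x) cat_data_scheme \<Rightarrow> 'm \<Rightarrow> 'm \<Rightarrow> 'm \<Rightarrow> 'm \<Rightarrow> bool" where
  "weak_pullback C f g m n \<longleftrightarrow>
     (\<exists>A B B' D. f \<in> Hom C A B \<and> g \<in> Hom C A B' \<and> m \<in> Hom C B D \<and> n \<in> Hom C B' D \<and>
        m \<cdot>\<^bsub>C\<^esub> f = n \<cdot>\<^bsub>C\<^esub> g \<and>
        (\<forall>S \<in> Obj C. \<forall>q \<in> Hom C S B. \<forall>p \<in> Hom C S B'. m \<cdot>\<^bsub>C\<^esub> q = n \<cdot>\<^bsub>C\<^esub> p \<longrightarrow>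
           (\<exists>r \<in> Hom C S A. f \<cdot>\<^bsub>C\<^esub> r = q \<and> g \<cdot>\<^bsub>C\<^esub> r = p)))"

definition preserves_weak_pullbacks ::
    "('o, 'm, 'x) cat_data_scheme \<Rightarrow> ('p, 'n, 'y) cat_data_scheme \<Rightarrow> ('m \<Rightarrow> 'n) \<Rightarrow> bool" where
  "preserves_weak_pullbacks C D F1 \<longleftrightarrow>
     (\<forall>f g m n. weak_pullback C f g m n \<longrightarrow> weak_pullback D (F1 f) (F1 g) (F1 m) (F1 n))"


section \<open>Symmetric monoidal categories\<close>

text \<open>
  Monoidal categories are not assumed strict: the associator, the unitors and the symmetry are
  part of the data and are written out wherever informal notation suppresses them.
\<close>

record ('o, 'm) smc_data = "('o, 'm) cat_data" +
  Tensor0 :: "'o \<Rightarrow> 'o \<Rightarrow> 'o" (infixr "\<otimes>\<^sub>0\<index>" 70)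
  Tensor1 :: "'m \<Rightarrow> 'm \<Rightarrow> 'm" (infixr "\<otimes>\<index>" 70)
  Unit :: 'o ("\<I>\<index>")
  Assoc :: "'o \<Rightarrow> 'o \<Rightarrow> 'o \<Rightarrow> 'm" ("\<a>\<index>")
  LUnit :: "'o \<Rightarrow> 'm" ("\<l>\<index>")
  RUnit :: "'o \<Rightarrow> 'm" ("\<r>\<index>")
  Swap :: "'o \<Rightarrow> 'o \<Rightarrow> 'm" ("\<s>\<index>")

locale symmetric_monoidal_category = category C
  for C :: "('o, 'm, 'x) smc_data_scheme" (structure) +
  assumes Tensor0_in_Obj: "\<lbrakk>X \<in> Obj C; Y \<in> Obj C\<rbrakk> \<Longrightarrow> X \<otimes>\<^sub>0 Y \<in> Obj C"
    and Unit_in_Obj: "\<I> \<in> Obj C"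
    and Tensor1_in_Hom: "\<lbrakk>f \<in> Hom C A B; g \<in> Hom C A' B'\<rbrakk>
      \<Longrightarrow> f \<otimes> g \<in> Hom C (A \<otimes>\<^sub>0 A') (B \<otimes>\<^sub>0 B')"
    and Tensor1_Id: "\<lbrakk>X \<in> Obj C; Y \<in> Obj C\<rbrakk> \<Longrightarrow> \<one> X \<otimes> \<one> Y = \<one> (X \<otimes>\<^sub>0 Y)"
    and Tensor1_Comp:
      "\<lbrakk>f \<in> Hom C A B; g \<in> Hom C B D; f' \<in> Hom C A' B'; g' \<in> Hom C B' D'\<rbrakk>
      \<Longrightarrow> (g \<cdot> f) \<otimes> (g' \<cdot> f') = (g \<otimes> g') \<cdot> (f \<otimes> f')"
    \<comment> \<open>natural isomorphisms\<close>
    and Assoc_in_Hom: "\<lbrakk>X \<in> Obj C; Y \<in> Obj C; Z \<in> Obj C\<rbrakk>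
      \<Longrightarrow> \<a> X Y Z \<in> Hom C ((X \<otimes>\<^sub>0 Y) \<otimes>\<^sub>0 Z) (X \<otimes>\<^sub>0 (Y \<otimes>\<^sub>0 Z))"
    and Assoc_iso: "\<lbrakk>X \<in> Obj C; Y \<in> Obj C; Z \<in> Obj C\<rbrakk> \<Longrightarrow> is_iso C (\<a> X Y Z)"
    and Assoc_natural: "\<lbrakk>f \<in> Hom C X X'; g \<in> Hom C Y Y'; h \<in> Hom C Z Z'\<rbrakk>
      \<Longrightarrow> \<a> X' Y' Z' \<cdot> ((f \<otimes> g) \<otimes> h) = (f \<otimes> (g \<otimes> h)) \<cdot> \<a> X Y Z"
    and LUnit_in_Hom: "X \<in> Obj C \<Longrightarrow> \<l> X \<in> Hom C (\<I> \<otimes>\<^sub>0 X) X"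
    and LUnit_iso: "X \<in> Obj C \<Longrightarrow> is_iso C (\<l> X)"
    and LUnit_natural: "f \<in> Hom C X Y \<Longrightarrow> \<l> Y \<cdot> (\<one> \<I> \<otimes> f) = f \<cdot> \<l> X"
    and RUnit_in_Hom: "X \<in> Obj C \<Longrightarrow> \<r> X \<in> Hom C (X \<otimes>\<^sub>0 \<I>) X"
    and RUnit_iso: "X \<in> Obj C \<Longrightarrow> is_iso C (\<r> X)"
    and RUnit_natural: "f \<in> Hom C X Y \<Longrightarrow> \<r> Y \<cdot> (f \<otimes> \<one> \<I>) = f \<cdot> \<r> X"
    and Swap_in_Hom: "\<lbrakk>X \<in> Obj C; Y \<in> Obj C\<rbrakk> \<Longrightarrow> \<s> X Y \<in> Hom C (X \<otimes>\<^sub>0 Y) (Y \<otimes>\<^sub>0 X)"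
    and Swap_natural: "\<lbrakk>f \<in> Hom C X X'; g \<in> Hom C Y Y'\<rbrakk>
      \<Longrightarrow> \<s> X' Y' \<cdot> (f \<otimes> g) = (g \<otimes> f) \<cdot> \<s> X Y"
    and Swap_Swap: "\<lbrakk>X \<in> Obj C; Y \<in> Obj C\<rbrakk> \<Longrightarrow> \<s> Y X \<cdot> \<s> X Y = \<one> (X \<otimes>\<^sub>0 Y)"
    \<comment> \<open>coherence\<close>
    and triangle: "\<lbrakk>X \<in> Obj C; Y \<in> Obj C\<rbrakk>
      \<Longrightarrow> (\<one> X \<otimes> \<l> Y) \<cdot> \<a> X \<I> Y = \<r> X \<otimes> \<one> Y"
    and pentagon: "\<lbrakk>W \<in> Obj C; X \<in> Obj C; Y \<in> Obj C; Z \<in> Obj C\<rbrakk>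
      \<Longrightarrow> (\<one> W \<otimes> \<a> X Y Z) \<cdot> \<a> W (X \<otimes>\<^sub>0 Y) Z \<cdot> (\<a> W X Y \<otimes> \<one> Z)
          = \<a> W X (Y \<otimes>\<^sub>0 Z) \<cdot> \<a> (W \<otimes>\<^sub>0 X) Y Z"
    and hexagon: "\<lbrakk>X \<in> Obj C; Y \<in> Obj C; Z \<in> Obj C\<rbrakk>
      \<Longrightarrow> (\<one> Y \<otimes> \<s> X Z) \<cdot> \<a> Y X Z \<cdot> (\<s> X Y \<otimes> \<one> Z)
          = \<a> Y Z X \<cdot> \<s> X (Y \<otimes>\<^sub>0 Z) \<cdot> \<a> X Y Z"
    and Swap_unit: "X \<in> Obj C \<Longrightarrow> \<l> X \<cdot> \<s> X \<I> = \<r> X"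

text \<open>The canonical map exchanging the two inner factors,
  \<open>(X \<otimes> X') \<otimes> (Y \<otimes> Y') \<rightarrow> (X \<otimes> Y) \<otimes> (X' \<otimes> Y')\<close>.\<close>

definition middle_swap ::
    "('o, 'm, 'x) smc_data_scheme \<Rightarrow> 'o \<Rightarrow> 'o \<Rightarrow> 'o \<Rightarrow> 'o \<Rightarrow> 'm" where
  "middle_swap C X X' Y Y' =
     inv_arr C (\<a>\<^bsub>C\<^esub> X Y (X' \<otimes>\<^sub>0\<^bsub>C\<^esub> Y'))
     \<cdot>\<^bsub>C\<^esub> (\<one>\<^bsub>C\<^esub> X \<otimes>\<^bsub>C\<^esub>
          (\<a>\<^bsub>C\<^esub> Y X' Y' \<cdot>\<^bsub>C\<^esub> (\<s>\<^bsub>C\<^esub> X' Y \<otimes>\<^bsub>C\<^esub> \<one>\<^bsub>C\<^esub> Y')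
            \<cdot>\<^bsub>C\<^esub> inv_arr C (\<a>\<^bsub>C\<^esub> X' Y Y')))
     \<cdot>\<^bsub>C\<^esub> \<a>\<^bsub>C\<^esub> X X' (Y \<otimes>\<^sub>0\<^bsub>C\<^esub> Y')"


section \<open>Markov categories\<close>

record ('o, 'm) markov_data = "('o, 'm) smc_data" +
  Copy :: "'o \<Rightarrow> 'm" ("copy\<index>")
  Del :: "'o \<Rightarrow> 'm" ("del\<index>")

locale markov_category = symmetric_monoidal_category C
  for C :: "('o, 'm, 'x) markov_data_scheme" (structure) +
  assumes Copy_in_Hom: "X \<in> Obj C \<Longrightarrow> copy X \<in> Hom C X (X \<otimes>\<^sub>0 X)"
    and Del_in_Hom: "X \<in> Obj C \<Longrightarrow> del X \<in> Hom C X \<I>"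
    \<comment> \<open>commutative comonoids\<close>
    and Copy_assoc: "X \<in> Obj C
      \<Longrightarrow> \<a> X X X \<cdot> (copy X \<otimes> \<one> X) \<cdot> copy X = (\<one> X \<otimes> copy X) \<cdot> copy X"
    and Copy_Del_left: "X \<in> Obj C \<Longrightarrow> \<l> X \<cdot> (del X \<otimes> \<one> X) \<cdot> copy X = \<one> X"
    and Copy_Del_right: "X \<in> Obj C \<Longrightarrow> \<r> X \<cdot> (\<one> X \<otimes> del X) \<cdot> copy X = \<one> X"
    and Copy_commute: "X \<in> Obj C \<Longrightarrow> \<s> X X \<cdot> copy X = copy X"
    \<comment> \<open>compatibility with the monoidal structure\<close>
    and Copy_Tensor: "\<lbrakk>X \<in> Obj C; Y \<in> Obj C\<rbrakk>
      \<Longrightarrow> copy (X \<otimes>\<^sub>0 Y) = middle_swap C X X Y Y \<cdot> (copy X \<otimes> copy Y)"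
    and Del_Tensor: "\<lbrakk>X \<in> Obj C; Y \<in> Obj C\<rbrakk>
      \<Longrightarrow> del (X \<otimes>\<^sub>0 Y) = \<l> \<I> \<cdot> (del X \<otimes> del Y)"
    and Copy_Unit: "\<l> \<I> \<cdot> copy \<I> = \<one> \<I>"
    and Del_Unit: "del \<I> = \<one> \<I>"
    \<comment> \<open>discarding is natural\<close>
    and Del_natural: "f \<in> Hom C X Y \<Longrightarrow> del Y \<cdot> f = del X"

definition deterministic :: "('o, 'm, 'x) markov_data_scheme \<Rightarrow> 'm \<Rightarrow> bool" where
  "deterministic C f \<longleftrightarrow>
     copy\<^bsub>C\<^esub> (Cod C f) \<cdot>\<^bsub>C\<^esub> f = (f \<otimes>\<^bsub>C\<^esub> f) \<cdot>\<^bsub>C\<^esub> copy\<^bsub>C\<^esub> (Dom C f)"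

definition det_cat :: "('o, 'm, 'x) markov_data_scheme \<Rightarrow> ('o, 'm) cat_data" where
  "det_cat C = \<lparr>Obj = Obj C, Arr = {f \<in> Arr C. deterministic C f},
     Dom = Dom C, Cod = Cod C, Id = Id C, Comp = Comp C\<rparr>"

text \<open>For \<open>f : A \<rightarrow> X \<otimes> Y\<close>, the marginal \<open>f\<^sub>X\<close> and conditionals with respect to \<open>X\<close>.\<close>

definition marginal :: "('o, 'm, 'x) markov_data_scheme \<Rightarrow> 'o \<Rightarrow> 'o \<Rightarrow> 'm \<Rightarrow> 'm" where
  "marginal C X Y f =
     \<r>\<^bsub>C\<^esub> X \<cdot>\<^bsub>C\<^esub> (\<one>\<^bsub>C\<^esub> X \<otimes>\<^bsub>C\<^esub> del\<^bsub>C\<^esub> Y) \<cdot>\<^bsub>C\<^esub> f"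

definition is_conditional ::
    "('o, 'm, 'x) markov_data_scheme \<Rightarrow> 'o \<Rightarrow> 'o \<Rightarrow> 'o \<Rightarrow> 'm \<Rightarrow> 'm \<Rightarrow> bool" where
  "is_conditional C A X Y f k \<longleftrightarrow>
     k \<in> Hom C (X \<otimes>\<^sub>0\<^bsub>C\<^esub> A) Y \<and>
     f = (\<one>\<^bsub>C\<^esub> X \<otimes>\<^bsub>C\<^esub> k)
         \<cdot>\<^bsub>C\<^esub> \<a>\<^bsub>C\<^esub> X X A
         \<cdot>\<^bsub>C\<^esub> (copy\<^bsub>C\<^esub> X \<otimes>\<^bsub>C\<^esub> \<one>\<^bsub>C\<^esub> A)
         \<cdot>\<^bsub>C\<^esub> (marginal C X Y f \<otimes>\<^bsub>C\<^esub> \<one>\<^bsub>C\<^esub> A)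
         \<cdot>\<^bsub>C\<^esub> copy\<^bsub>C\<^esub> A"

text \<open>A conditional of \<open>f : A \<rightarrow> X \<otimes> Y\<close> with respect to the second output \<open>Y\<close> is one of
  \<open>\<s> X Y \<cdot> f\<close> with respect to the first, so quantifying over all arrows covers every output.\<close>

definition has_conditionals :: "('o, 'm, 'x) markov_data_scheme \<Rightarrow> bool" where
  "has_conditionals C \<longleftrightarrow>
     (\<forall>A \<in> Obj C. \<forall>X \<in> Obj C. \<forall>Y \<in> Obj C. \<forall>f \<in> Hom C A (X \<otimes>\<^sub>0\<^bsub>C\<^esub> Y).
        \<exists>k. is_conditional C A X Y f k)"

definition as_equal ::
    "('o, 'm, 'x) markov_data_scheme \<Rightarrow> 'm \<Rightarrow> 'm \<Rightarrow> 'm \<Rightarrow> bool" where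
  "as_equal C p f g \<longleftrightarrow>
     (\<one>\<^bsub>C\<^esub> (Cod C p) \<otimes>\<^bsub>C\<^esub> f) \<cdot>\<^bsub>C\<^esub> copy\<^bsub>C\<^esub> (Cod C p) \<cdot>\<^bsub>C\<^esub> p =
     (\<one>\<^bsub>C\<^esub> (Cod C p) \<otimes>\<^bsub>C\<^esub> g) \<cdot>\<^bsub>C\<^esub> copy\<^bsub>C\<^esub> (Cod C p) \<cdot>\<^bsub>C\<^esub> p"

definition equalizer_principle :: "('o, 'm, 'x) markov_data_scheme \<Rightarrow> bool" where
  "equalizer_principle C \<longleftrightarrow>
     has_equalizers (det_cat C) \<and>
     (\<forall>f g e. is_equalizer (det_cat C) f g e \<longrightarrow>
        (\<forall>A \<in> Obj C. \<forall>p \<in> Hom C A (Cod C e). as_equal C p f g \<longrightarrow>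
           (\<exists>!r. r \<in> Hom C A (Dom C e) \<and> e \<cdot>\<^bsub>C\<^esub> r = p)))"


section \<open>Representability and the distribution functor\<close>

definition is_distribution_object ::
    "('o, 'm, 'x) markov_data_scheme \<Rightarrow> 'o \<Rightarrow> 'o \<Rightarrow> 'm \<Rightarrow> bool" where
  "is_distribution_object C X PX s \<longleftrightarrow>
     s \<in> Hom C PX X \<and>
     (\<forall>A \<in> Obj C. bij_betw (\<lambda>h. s \<cdot>\<^bsub>C\<^esub> h) (Hom (det_cat C) A PX) (Hom C A X))"

definition representable :: "('o, 'm, 'x) markov_data_scheme \<Rightarrow> bool" where
  "representable C \<longleftrightarrow> (\<forall>X \<in> Obj C. \<exists>PX s. is_distribution_object C X PX s)"

text \<open>\<open>P\<close> depends on a choice of distribution objects, made explicit here.\<close>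

definition distribution_objects ::
    "('o, 'm, 'x) markov_data_scheme \<Rightarrow> ('o \<Rightarrow> 'o) \<Rightarrow> ('o \<Rightarrow> 'm) \<Rightarrow> bool" where
  "distribution_objects C P samp \<longleftrightarrow> (\<forall>X \<in> Obj C. is_distribution_object C X (P X) (samp X))"

lemma representable_iff_distribution_objects:
  "representable C \<longleftrightarrow> (\<exists>P samp. distribution_objects C P samp)"
proof
  assume "representable C"
  then have "\<forall>X \<in> Obj C. \<exists>c. is_distribution_object C X (fst c) (snd c)"
    by (simp add: representable_def)
  from bchoice[OF this] obtain c where
    "\<forall>X \<in> Obj C. is_distribution_object C X (fst (c X)) (snd (c X))" by blast
  then have "distribution_objects C (\<lambda>X. fst (c X)) (\<lambda>X. snd (c X))"
    by (simp add: distribution_objects_def)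
  then show "\<exists>P samp. distribution_objects C P samp" by blast
qed (auto simp: representable_def distribution_objects_def)

definition sharp ::
    "('o, 'm, 'x) markov_data_scheme \<Rightarrow> ('o \<Rightarrow> 'o) \<Rightarrow> ('o \<Rightarrow> 'm) \<Rightarrow> 'm \<Rightarrow> 'm" where
  "sharp C P samp f =
     inv_into (Hom (det_cat C) (Dom C f) (P (Cod C f))) (\<lambda>h. samp (Cod C f) \<cdot>\<^bsub>C\<^esub> h) f"

definition dist_map ::
    "('o, 'm, 'x) markov_data_scheme \<Rightarrow> ('o \<Rightarrow> 'o) \<Rightarrow> ('o \<Rightarrow> 'm) \<Rightarrow> 'm \<Rightarrow> 'm" where
  "dist_map C P samp f = sharp C P samp (f \<cdot>\<^bsub>C\<^esub> samp (Dom C f))"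

context markov_category
begin

lemma Hom_det_cat: "f \<in> Hom (det_cat C) A B \<longleftrightarrow> f \<in> Hom C A B \<and> deterministic C f"
  by (auto simp: Hom_def det_cat_def)

lemma det_cat_simps [simp]:
  "Obj (det_cat C) = Obj C" "Id (det_cat C) = Id C" "Comp (det_cat C) = Comp C"
  "Dom (det_cat C) = Dom C" "Cod (det_cat C) = Cod C"
  by (simp_all add: det_cat_def)

lemma Hom_D: "f \<in> Hom C A B \<Longrightarrow> A \<in> Obj C \<and> B \<in> Obj C \<and> Dom C f = A \<and> Cod C f = B"
  using Dom_in_Obj Cod_in_Obj by (auto simp: Hom_def)

lemma deterministic_Id: "A \<in> Obj C \<Longrightarrow> deterministic C (\<one> A)"
  using Hom_D[OF Id_in_Hom[of A]] Comp_Id_left[OF Copy_in_Hom[of A]] Comp_Id_right[OF Copy_in_Hom[of A]]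
  by (simp add: deterministic_def Tensor1_Id)

lemma deterministic_Comp:
  assumes f: "f \<in> Hom C A B" "deterministic C f" and g: "g \<in> Hom C B D" "deterministic C g"
  shows "deterministic C (g \<cdot> f)"
proof -
  have o: "A \<in> Obj C" "B \<in> Obj C" "D \<in> Obj C" using f g Hom_D by auto
  have gf: "g \<cdot> f \<in> Hom C A D" using Comp_in_Hom f(1) g(1) .
  have "copy D \<cdot> g \<cdot> f = (copy D \<cdot> g) \<cdot> f"
    using Comp_assoc[OF f(1) g(1) Copy_in_Hom] o by simp
  also have "\<dots> = ((g \<otimes> g) \<cdot> copy B) \<cdot> f"
    using g Hom_D[OF g(1)] by (simp add: deterministic_def)
  also have "\<dots> = (g \<otimes> g) \<cdot> copy B \<cdot> f"
    using Comp_assoc[OF f(1) Copy_in_Hom Tensor1_in_Hom[OF g(1) g(1)]] o by simp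
  also have "\<dots> = (g \<otimes> g) \<cdot> (f \<otimes> f) \<cdot> copy A"
    using f Hom_D[OF f(1)] by (simp add: deterministic_def)
  also have "\<dots> = ((g \<otimes> g) \<cdot> (f \<otimes> f)) \<cdot> copy A"
    using Comp_assoc[OF Copy_in_Hom Tensor1_in_Hom[OF f(1) f(1)] Tensor1_in_Hom[OF g(1) g(1)]] o by simp
  also have "\<dots> = ((g \<cdot> f) \<otimes> (g \<cdot> f)) \<cdot> copy A"
    using Tensor1_Comp[OF f(1) g(1) f(1) g(1)] by simp
  finally show ?thesis using Hom_D[OF gf] by (simp add: deterministic_def)
qed

lemma category_det_cat: "category (det_cat C)"
proof
  show "f \<in> Arr (det_cat C) \<Longrightarrow> Dom (det_cat C) f \<in> Obj (det_cat C)" for f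
    by (simp add: det_cat_def Dom_in_Obj)
  show "f \<in> Arr (det_cat C) \<Longrightarrow> Cod (det_cat C) f \<in> Obj (det_cat C)" for f
    by (simp add: det_cat_def Cod_in_Obj)
qed (auto simp: Hom_det_cat deterministic_Id Id_in_Hom intro: Comp_in_Hom deterministic_Comp
       Comp_Id_left Comp_Id_right Comp_assoc)

lemma sharp:
  assumes P: "distribution_objects C P samp" and f: "f \<in> Hom C A X"
  shows "sharp C P samp f \<in> Hom (det_cat C) A (P X)" "samp X \<cdot> sharp C P samp f = f"
    and "\<And>h. \<lbrakk>h \<in> Hom (det_cat C) A (P X); samp X \<cdot> h = f\<rbrakk> \<Longrightarrow> h = sharp C P samp f"
proof -
  have b: "bij_betw (\<lambda>h. samp X \<cdot> h) (Hom (det_cat C) A (P X)) (Hom C A X)"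
    using P Hom_D[OF f] by (auto simp: distribution_objects_def is_distribution_object_def)
  have e: "sharp C P samp f = inv_into (Hom (det_cat C) A (P X)) (\<lambda>h. samp X \<cdot> h) f"
    using Hom_D[OF f] by (simp add: sharp_def)
  show "sharp C P samp f \<in> Hom (det_cat C) A (P X)"
    unfolding e using b f by (auto simp: bij_betw_def intro: inv_into_into)
  show "samp X \<cdot> sharp C P samp f = f"
    unfolding e using bij_betw_inv_into_right[OF b f] .
  show "\<And>h. \<lbrakk>h \<in> Hom (det_cat C) A (P X); samp X \<cdot> h = f\<rbrakk> \<Longrightarrow> h = sharp C P samp f"
    unfolding e using bij_betw_inv_into_left[OF b] by auto
qed

lemma samp_in_Hom:
  "\<lbrakk>distribution_objects C P samp; X \<in> Obj C\<rbrakk> \<Longrightarrow> samp X \<in> Hom C (P X) X"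
  by (simp add: distribution_objects_def is_distribution_object_def)

lemma dist_map:
  assumes P: "distribution_objects C P samp" and f: "f \<in> Hom C X Y"
  shows "dist_map C P samp f \<in> Hom (det_cat C) (P X) (P Y)"
    and "samp Y \<cdot> dist_map C P samp f = f \<cdot> samp X"
    and "\<And>h. \<lbrakk>h \<in> Hom (det_cat C) (P X) (P Y); samp Y \<cdot> h = f \<cdot> samp X\<rbrakk>
      \<Longrightarrow> h = dist_map C P samp f"
proof -
  have "f \<cdot> samp X \<in> Hom C (P X) Y"
    using Comp_in_Hom[OF samp_in_Hom[OF P] f] Hom_D[OF f] by simp
  note s = sharp[OF P this]
  have e: "dist_map C P samp f = sharp C P samp (f \<cdot> samp X)"
    using Hom_D[OF f] by (simp add: dist_map_def)
  show "dist_map C P samp f \<in> Hom (det_cat C) (P X) (P Y)"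
    unfolding e by (rule s(1))
  show "samp Y \<cdot> dist_map C P samp f = f \<cdot> samp X"
    unfolding e by (rule s(2))
  show "\<And>h. \<lbrakk>h \<in> Hom (det_cat C) (P X) (P Y); samp Y \<cdot> h = f \<cdot> samp X\<rbrakk>
      \<Longrightarrow> h = dist_map C P samp f"
    unfolding e by (rule s(3))
qed

lemma functor_dist_map:
  assumes P: "distribution_objects C P samp"
  shows "cat_functor C (det_cat C) P (dist_map C P samp)"
proof -
  interpret D: category "det_cat C" by (rule category_det_cat)
  show ?thesis
  proof
    fix A assume A: "A \<in> Obj C"
    note s = samp_in_Hom[OF P A]
    show PA: "P A \<in> Obj (det_cat C)" using Hom_D[OF s] by simp
    have "samp A \<cdot> \<one> (P A) = \<one> A \<cdot> samp A" using Comp_Id_left[OF s] Comp_Id_right[OF s] by simp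
    then show "dist_map C P samp (\<one> A) = \<one>\<^bsub>det_cat C\<^esub> (P A)"
      using dist_map(3)[OF P Id_in_Hom[OF A]] D.Id_in_Hom[OF PA] by auto
  next
    fix f A B assume "f \<in> Hom C A B"
    then show "dist_map C P samp f \<in> Hom (det_cat C) (P A) (P B)" by (rule dist_map(1)[OF P])
  next
    fix f A B g E assume f: "f \<in> Hom C A B" and g: "g \<in> Hom C B E"
    let ?F = "dist_map C P samp"
    have F: "?F f \<in> Hom C (P A) (P B)" and G: "?F g \<in> Hom C (P B) (P E)"
      using dist_map(1)[OF P f] dist_map(1)[OF P g] by (auto simp: Hom_det_cat)
    have s: "samp A \<in> Hom C (P A) A" "samp B \<in> Hom C (P B) B" "samp E \<in> Hom C (P E) E"
      using samp_in_Hom[OF P] Hom_D[OF f] Hom_D[OF g] by auto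
    have "samp E \<cdot> ?F g \<cdot> ?F f = (samp E \<cdot> ?F g) \<cdot> ?F f" using Comp_assoc[OF F G s(3)] by simp
    also have "\<dots> = g \<cdot> samp B \<cdot> ?F f" using dist_map(2)[OF P g] Comp_assoc[OF F s(2) g] by simp
    also have "\<dots> = (g \<cdot> f) \<cdot> samp A" using dist_map(2)[OF P f] Comp_assoc[OF s(1) f g] by simp
    finally have "?F g \<cdot> ?F f = ?F (g \<cdot> f)"
      using dist_map(3)[OF P Comp_in_Hom[OF f g]]
        D.Comp_in_Hom[OF dist_map(1)[OF P f] dist_map(1)[OF P g]] by simp
    then show "?F (g \<cdot> f) = ?F g \<cdot>\<^bsub>det_cat C\<^esub> ?F f" by simp
  qed
qed

lemma functor_dist_map_det:
  assumes P: "distribution_objects C P samp"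
  shows "cat_functor (det_cat C) (det_cat C) P (dist_map C P samp)"
proof -
  interpret F: cat_functor C "det_cat C" P "dist_map C P samp" by (rule functor_dist_map[OF P])
  interpret D: category "det_cat C" by (rule category_det_cat)
  show ?thesis
    by unfold_locales
      (use F.maps_Obj F.maps_Hom F.maps_Id F.maps_Comp in \<open>auto simp: Hom_det_cat\<close>)
qed

end

end

theory Submission
  imports Defs
begin

text \<open>
  Deterministic arrows \<open>S \<rightarrow> P X\<close> are the same as arbitrary arrows \<open>S \<rightarrow> X\<close>, and under this
  bijection postcomposition with \<open>P f\<close> becomes postcomposition with \<open>f\<close>
  (\<open>dist_map_samp_eq\<close>). So \<open>P\<close> preserves a weak pullback of deterministic arrows
  \<open>f : A \<rightarrow> B\<close>, \<open>g : A \<rightarrow> B'\<close> over \<open>m : B \<rightarrow> D\<close>, \<open>n : B' \<rightarrow> D\<close> as soon as its lifting property,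
  which is given for deterministic \<open>q : S \<rightarrow> B\<close>, \<open>p : S \<rightarrow> B'\<close> with \<open>m q = n p\<close>, holds for arbitrary
  such \<open>q\<close> and \<open>p\<close> (\<open>weak_pullback_lift\<close>).

  Conditionals and the equalizer principle reduce arbitrary \<open>q\<close> and \<open>p\<close> to deterministic ones.
  Draw \<open>b'\<close> from \<open>p\<close>, and then \<open>b\<close> from the conditional of \<open>q\<close> given that \<open>m b = n b'\<close>. The
  result is a joint arrow \<open>h : S \<rightarrow> B' \<otimes> B\<close> with marginals \<open>p\<close> and \<open>q\<close> for which the pair
  \<open>(n b', m b)\<close> is distributed as a copied variable (\<open>coupling_over\<close>). The components of such a
  pair are almost surely equal in the strong sense of \<open>as_equal\<close>, which keeps track of
  \<open>(b', b)\<close> too: after conditioning \<open>(b', b)\<close> on the pair, its two components may be exchanged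
  (\<open>as_equal_if_diagonal\<close>). By the equalizer principle \<open>h\<close> then factors through the equalizer \<open>E\<close>
  of the deterministic arrows \<open>(b', b) \<mapsto> n b'\<close> and \<open>(b', b) \<mapsto> m b\<close>. The two projections
  restricted to \<open>E\<close> are deterministic and agree over \<open>D\<close>, hence lift to an arrow \<open>E \<rightarrow> A\<close>, and
  composing it with \<open>S \<rightarrow> E\<close> gives the required lift of \<open>q\<close> and \<open>p\<close>.

  The rest is bookkeeping for the non-strict monoidal structure. The facts it has to provide are
  that projections and copying are deterministic, that the pairing of the two projections is the
  identity, and that the construction \<open>extend\<close>, which occurs in the definition of
  conditionals, is natural for deterministic arrows (\<open>Tensor_deterministic_extend\<close>).
\<close>

section \<open>Categories\<close>

context category
begin

text \<open>
  Typing facts are stated with \<open>Dom\<close> and \<open>Cod\<close> instead of \<open>Hom\<close>, so that no intermediate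
  object has to be guessed and the simplifier computes the types of composites by itself.
  Composites are normalized to the right.
\<close>

lemma Id_simps [simp]:
  assumes "A \<in> Obj C"
  shows "\<one> A \<in> Arr C" "Dom C (\<one> A) = A" "Cod C (\<one> A) = A"
  using Id_in_Hom[OF assms] by (auto simp: Hom_def)

lemma Comp_simps [simp]:
  assumes "f \<in> Arr C" "g \<in> Arr C" "Dom C g = Cod C f"
  shows "g \<cdot> f \<in> Arr C" "Dom C (g \<cdot> f) = Dom C f" "Cod C (g \<cdot> f) = Cod C g"
  using Comp_in_Hom[of f "Dom C f" "Cod C f" g "Cod C g"] assms by (auto simp: Hom_def)

lemma Comp_Id [simp]:
  "\<lbrakk>f \<in> Arr C; Cod C f = B\<rbrakk> \<Longrightarrow> \<one> B \<cdot> f = f"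
  "\<lbrakk>f \<in> Arr C; Dom C f = A\<rbrakk> \<Longrightarrow> f \<cdot> \<one> A = f"
  using Comp_Id_left Comp_Id_right by (auto simp: Hom_def)

lemma Comp_assoc_arr [simp]:
  assumes "f \<in> Arr C" "g \<in> Arr C" "h \<in> Arr C" "Dom C g = Cod C f" "Dom C h = Cod C g"
  shows "(h \<cdot> g) \<cdot> f = h \<cdot> g \<cdot> f"
  using Comp_assoc[of f "Dom C f" "Cod C f" g "Cod C g" h "Cod C h"] assms by (auto simp: Hom_def)

lemma inverse_arrows_unique:
  assumes "inverse_arrows C f g" "inverse_arrows C f h"
  shows "g = h"
proof -
  have t: "f \<in> Arr C" "g \<in> Arr C" "h \<in> Arr C" "Dom C g = Cod C f" "Cod C g = Dom C f"
    "Dom C h = Cod C f" "Cod C h = Dom C f"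
    using assms by (auto simp: inverse_arrows_def Hom_def)
  have "g = g \<cdot> f \<cdot> h"
    using assms t by (simp add: inverse_arrows_def)
  also have "\<dots> = (g \<cdot> f) \<cdot> h"
    using t by simp
  also have "\<dots> = h"
    using assms t by (simp add: inverse_arrows_def del: Comp_assoc_arr)
  finally show ?thesis .
qed

lemma inv_arr_simps:
  assumes "is_iso C f"
  shows "inv_arr C f \<in> Arr C" "Dom C (inv_arr C f) = Cod C f" "Cod C (inv_arr C f) = Dom C f"
    "inv_arr C f \<cdot> f = \<one> (Dom C f)" "f \<cdot> inv_arr C f = \<one> (Cod C f)"
proof -
  have "inverse_arrows C f (inv_arr C f)"
    using assms inverse_arrows_unique unfolding is_iso_def inv_arr_def by (metis the_equality)
  then show "inv_arr C f \<in> Arr C" "Dom C (inv_arr C f) = Cod C f" "Cod C (inv_arr C f) = Dom C f"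
    "inv_arr C f \<cdot> f = \<one> (Dom C f)" "f \<cdot> inv_arr C f = \<one> (Cod C f)"
    by (auto simp: inverse_arrows_def Hom_def)
qed

lemma iso_cancel_left:
  assumes "is_iso C i" "i \<in> Arr C" "f \<in> Arr C" "g \<in> Arr C"
    and "Dom C i = Cod C f" "Dom C i = Cod C g" "i \<cdot> f = i \<cdot> g"
  shows "f = g"
proof -
  have "(inv_arr C i \<cdot> i) \<cdot> f = (inv_arr C i \<cdot> i) \<cdot> g"
    using assms inv_arr_simps(1-3)[OF assms(1)] by simp
  then show ?thesis
    using assms inv_arr_simps(4)[OF assms(1)] by (simp del: Comp_assoc_arr)
qed

lemma iso_cancel_right:
  assumes "is_iso C i" "i \<in> Arr C" "f \<in> Arr C" "g \<in> Arr C"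
    and "Dom C f = Cod C i" "Dom C g = Cod C i" "f \<cdot> i = g \<cdot> i"
  shows "f = g"
proof -
  have "(f \<cdot> i) \<cdot> inv_arr C i = (g \<cdot> i) \<cdot> inv_arr C i"
    using assms by simp
  then show ?thesis
    using assms(2-6) inv_arr_simps[OF assms(1)] by simp
qed

end

section \<open>Coherence in a symmetric monoidal category\<close>

context symmetric_monoidal_category
begin

lemma Tensor_simps [simp]:
  "\<lbrakk>X \<in> Obj C; Y \<in> Obj C\<rbrakk> \<Longrightarrow> X \<otimes>\<^sub>0 Y \<in> Obj C"
  "\<I> \<in> Obj C"
  "\<lbrakk>X \<in> Obj C; Y \<in> Obj C\<rbrakk> \<Longrightarrow> \<one> X \<otimes> \<one> Y = \<one> (X \<otimes>\<^sub>0 Y)"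
  "\<lbrakk>f \<in> Arr C; g \<in> Arr C\<rbrakk> \<Longrightarrow> f \<otimes> g \<in> Arr C"
  "\<lbrakk>f \<in> Arr C; g \<in> Arr C\<rbrakk> \<Longrightarrow> Dom C (f \<otimes> g) = Dom C f \<otimes>\<^sub>0 Dom C g"
  "\<lbrakk>f \<in> Arr C; g \<in> Arr C\<rbrakk> \<Longrightarrow> Cod C (f \<otimes> g) = Cod C f \<otimes>\<^sub>0 Cod C g"
  using Tensor0_in_Obj Unit_in_Obj Tensor1_Id
    Tensor1_in_Hom[of f "Dom C f" "Cod C f" g "Dom C g" "Cod C g"]
  by (auto simp: Hom_def)

text \<open>
  Used from left to right, interchange merges adjacent tensors into one. Facts about a composite
  \<open>g \<cdot> f\<close> often come in a second version with a trailing factor \<open>x\<close>, since \<open>g \<cdot> f\<close> is no subterm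
  of the right-normalized \<open>g \<cdot> f \<cdot> x\<close>.
\<close>

lemma interchange [simp]:
  assumes "f \<in> Arr C" "g \<in> Arr C" "f' \<in> Arr C" "g' \<in> Arr C"
    and "Dom C g = Cod C f" "Dom C g' = Cod C f'"
  shows "(g \<otimes> g') \<cdot> (f \<otimes> f') = (g \<cdot> f) \<otimes> (g' \<cdot> f')"
  using Tensor1_Comp[of f "Dom C f" "Cod C f" g "Cod C g" f' "Dom C f'" "Cod C f'" g' "Cod C g'"]
    assms by (simp add: Hom_def)

lemma interchange_Comp [simp]:
  assumes "f \<in> Arr C" "g \<in> Arr C" "f' \<in> Arr C" "g' \<in> Arr C"
    and "Dom C g = Cod C f" "Dom C g' = Cod C f'"
    and "x \<in> Arr C" "Cod C x = Dom C f \<otimes>\<^sub>0 Dom C f'"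
  shows "(g \<otimes> g') \<cdot> (f \<otimes> f') \<cdot> x = ((g \<cdot> f) \<otimes> (g' \<cdot> f')) \<cdot> x"
  using assms interchange[OF assms(1-6)] Comp_assoc_arr[of x "f \<otimes> f'" "g \<otimes> g'"] by simp

lemma Assoc_simps [simp]:
  assumes "X \<in> Obj C" "Y \<in> Obj C" "Z \<in> Obj C"
  shows "\<a> X Y Z \<in> Arr C"
    "Dom C (\<a> X Y Z) = (X \<otimes>\<^sub>0 Y) \<otimes>\<^sub>0 Z"
    "Cod C (\<a> X Y Z) = X \<otimes>\<^sub>0 (Y \<otimes>\<^sub>0 Z)"
    "inv_arr C (\<a> X Y Z) \<in> Arr C"
    "Dom C (inv_arr C (\<a> X Y Z)) = X \<otimes>\<^sub>0 (Y \<otimes>\<^sub>0 Z)"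
    "Cod C (inv_arr C (\<a> X Y Z)) = (X \<otimes>\<^sub>0 Y) \<otimes>\<^sub>0 Z"
    "inv_arr C (\<a> X Y Z) \<cdot> \<a> X Y Z = \<one> ((X \<otimes>\<^sub>0 Y) \<otimes>\<^sub>0 Z)"
    "\<a> X Y Z \<cdot> inv_arr C (\<a> X Y Z) = \<one> (X \<otimes>\<^sub>0 (Y \<otimes>\<^sub>0 Z))"
  using Assoc_in_Hom[OF assms] inv_arr_simps[OF Assoc_iso[OF assms]] by (auto simp: Hom_def)

lemma Assoc_inv_Comp [simp]:
  assumes "X \<in> Obj C" "Y \<in> Obj C" "Z \<in> Obj C" "x \<in> Arr C"
  shows "Cod C x = (X \<otimes>\<^sub>0 Y) \<otimes>\<^sub>0 Z \<Longrightarrow> inv_arr C (\<a> X Y Z) \<cdot> \<a> X Y Z \<cdot> x = x"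
    "Cod C x = X \<otimes>\<^sub>0 (Y \<otimes>\<^sub>0 Z) \<Longrightarrow> \<a> X Y Z \<cdot> inv_arr C (\<a> X Y Z) \<cdot> x = x"
  using assms Comp_assoc_arr[of x "\<a> X Y Z" "inv_arr C (\<a> X Y Z)"]
    Comp_assoc_arr[of x "inv_arr C (\<a> X Y Z)" "\<a> X Y Z"] by auto

lemma Unitor_simps [simp]:
  assumes "X \<in> Obj C"
  shows "\<l> X \<in> Arr C" "Dom C (\<l> X) = \<I> \<otimes>\<^sub>0 X" "Cod C (\<l> X) = X"
    "\<r> X \<in> Arr C" "Dom C (\<r> X) = X \<otimes>\<^sub>0 \<I>" "Cod C (\<r> X) = X"
  using LUnit_in_Hom[OF assms] RUnit_in_Hom[OF assms] by (auto simp: Hom_def)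

lemma Swap_simps [simp]:
  assumes "X \<in> Obj C" "Y \<in> Obj C"
  shows "\<s> X Y \<in> Arr C" "Dom C (\<s> X Y) = X \<otimes>\<^sub>0 Y" "Cod C (\<s> X Y) = Y \<otimes>\<^sub>0 X"
  using Swap_in_Hom[OF assms] by (auto simp: Hom_def)

lemma Assoc_nat:
  assumes "f \<in> Arr C" "g \<in> Arr C" "h \<in> Arr C"
    and "Cod C f = X" "Cod C g = Y" "Cod C h = Z"
  shows "\<a> X Y Z \<cdot> ((f \<otimes> g) \<otimes> h) = (f \<otimes> (g \<otimes> h)) \<cdot> \<a> (Dom C f) (Dom C g) (Dom C h)"
  using Assoc_natural[of f "Dom C f" X g "Dom C g" Y h "Dom C h" Z] assms by (simp add: Hom_def)

lemma Assoc_nat_Comp: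
  assumes "f \<in> Arr C" "g \<in> Arr C" "h \<in> Arr C"
    and "Cod C f = X" "Cod C g = Y" "Cod C h = Z"
    and "x \<in> Arr C" "Cod C x = (Dom C f \<otimes>\<^sub>0 Dom C g) \<otimes>\<^sub>0 Dom C h"
  shows "\<a> X Y Z \<cdot> ((f \<otimes> g) \<otimes> h) \<cdot> x
    = (f \<otimes> (g \<otimes> h)) \<cdot> \<a> (Dom C f) (Dom C g) (Dom C h) \<cdot> x"
proof -
  have "\<a> X Y Z \<cdot> ((f \<otimes> g) \<otimes> h) \<cdot> x = (\<a> X Y Z \<cdot> ((f \<otimes> g) \<otimes> h)) \<cdot> x"
    using assms Cod_in_Obj by auto
  then show ?thesis
    unfolding Assoc_nat[OF assms(1-6)] using assms Dom_in_Obj Cod_in_Obj by auto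
qed

lemma Assoc_inv_nat:
  assumes "f \<in> Arr C" "g \<in> Arr C" "h \<in> Arr C"
    and "Cod C f = X" "Cod C g = Y" "Cod C h = Z"
  shows "inv_arr C (\<a> X Y Z) \<cdot> (f \<otimes> (g \<otimes> h))
    = ((f \<otimes> g) \<otimes> h) \<cdot> inv_arr C (\<a> (Dom C f) (Dom C g) (Dom C h))"
proof (rule iso_cancel_left)
  have o: "Dom C f \<in> Obj C" "Dom C g \<in> Obj C" "Dom C h \<in> Obj C" "X \<in> Obj C" "Y \<in> Obj C" "Z \<in> Obj C"
    using assms Dom_in_Obj Cod_in_Obj by auto
  show "is_iso C (\<a> X Y Z)"
    using o by (simp add: Assoc_iso)
  show "\<a> X Y Z \<cdot> inv_arr C (\<a> X Y Z) \<cdot> (f \<otimes> (g \<otimes> h))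
    = \<a> X Y Z \<cdot> ((f \<otimes> g) \<otimes> h) \<cdot> inv_arr C (\<a> (Dom C f) (Dom C g) (Dom C h))"
    using assms o by (simp add: Assoc_nat_Comp)
qed (use assms Dom_in_Obj Cod_in_Obj in auto)

lemma LUnit_nat:
  "\<lbrakk>f \<in> Arr C; Cod C f = Y\<rbrakk> \<Longrightarrow> \<l> Y \<cdot> (\<one> \<I> \<otimes> f) = f \<cdot> \<l> (Dom C f)"
  using LUnit_natural[of f "Dom C f" Y] by (simp add: Hom_def)

lemma RUnit_nat:
  "\<lbrakk>f \<in> Arr C; Cod C f = Y\<rbrakk> \<Longrightarrow> \<r> Y \<cdot> (f \<otimes> \<one> \<I>) = f \<cdot> \<r> (Dom C f)"
  using RUnit_natural[of f "Dom C f" Y] by (simp add: Hom_def)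

lemma Swap_nat:
  "\<lbrakk>f \<in> Arr C; g \<in> Arr C; Cod C f = X; Cod C g = Y\<rbrakk>
    \<Longrightarrow> \<s> X Y \<cdot> (f \<otimes> g) = (g \<otimes> f) \<cdot> \<s> (Dom C f) (Dom C g)"
  using Swap_natural[of f "Dom C f" X g "Dom C g" Y] by (simp add: Hom_def)

lemma Tensor_Unit_faithful_left:
  assumes "f \<in> Arr C" "g \<in> Arr C" "Dom C f = Dom C g" "Cod C f = Cod C g"
    and "\<one> \<I> \<otimes> f = \<one> \<I> \<otimes> g"
  shows "f = g"
proof (rule iso_cancel_right)
  show "is_iso C (\<l> (Dom C g))"
    using assms Dom_in_Obj by (blast intro: LUnit_iso)
  show "f \<cdot> \<l> (Dom C g) = g \<cdot> \<l> (Dom C g)"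
    using LUnit_nat[of f] LUnit_nat[of g] assms by simp
qed (use assms Dom_in_Obj in auto)

lemma Tensor_Unit_faithful_right:
  assumes "f \<in> Arr C" "g \<in> Arr C" "Dom C f = Dom C g" "Cod C f = Cod C g"
    and "f \<otimes> \<one> \<I> = g \<otimes> \<one> \<I>"
  shows "f = g"
proof (rule iso_cancel_right)
  show "is_iso C (\<r> (Dom C g))"
    using assms Dom_in_Obj by (blast intro: RUnit_iso)
  show "f \<cdot> \<r> (Dom C g) = g \<cdot> \<r> (Dom C g)"
    using RUnit_nat[of f] RUnit_nat[of g] assms by simp
qed (use assms Dom_in_Obj in auto)

text \<open>
  Kelly's argument: tensoring with \<open>\<I>\<close> is faithful, and after it the pentagon for
  \<open>X, Y, \<I>, \<I>\<close> can be combined with two triangles.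
\<close>

lemma RUnit_Assoc:
  assumes o: "X \<in> Obj C" "Y \<in> Obj C"
  shows "(\<one> X \<otimes> \<r> Y) \<cdot> \<a> X Y \<I> = \<r> (X \<otimes>\<^sub>0 Y)"
proof (rule Tensor_Unit_faithful_right)
  have "\<a> X Y \<I> \<cdot> (((\<one> X \<otimes> \<r> Y) \<cdot> \<a> X Y \<I>) \<otimes> \<one> \<I>)
      = \<a> X Y \<I> \<cdot> ((\<one> X \<otimes> \<r> Y) \<otimes> \<one> \<I>) \<cdot> (\<a> X Y \<I> \<otimes> \<one> \<I>)"
    using o by simp
  also have "\<dots> = (\<one> X \<otimes> (\<r> Y \<otimes> \<one> \<I>)) \<cdot> \<a> X (Y \<otimes>\<^sub>0 \<I>) \<I> \<cdot> (\<a> X Y \<I> \<otimes> \<one> \<I>)"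
    using o by (subst Assoc_nat_Comp) auto
  also have "\<dots> = (\<one> X \<otimes> (\<one> Y \<otimes> \<l> \<I>))
      \<cdot> (\<one> X \<otimes> \<a> Y \<I> \<I>) \<cdot> \<a> X (Y \<otimes>\<^sub>0 \<I>) \<I> \<cdot> (\<a> X Y \<I> \<otimes> \<one> \<I>)"
    using o by (simp add: triangle)
  also have "\<dots> = (\<one> X \<otimes> (\<one> Y \<otimes> \<l> \<I>)) \<cdot> \<a> X Y (\<I> \<otimes>\<^sub>0 \<I>) \<cdot> \<a> (X \<otimes>\<^sub>0 Y) \<I> \<I>"
    unfolding pentagon[OF o Unit_in_Obj Unit_in_Obj] ..
  also have "\<dots> = \<a> X Y \<I> \<cdot> ((\<one> X \<otimes> \<one> Y) \<otimes> \<l> \<I>) \<cdot> \<a> (X \<otimes>\<^sub>0 Y) \<I> \<I>"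
    using o by (subst Assoc_nat_Comp) auto
  also have "\<dots> = \<a> X Y \<I> \<cdot> (\<r> (X \<otimes>\<^sub>0 Y) \<otimes> \<one> \<I>)"
    using o triangle[of "X \<otimes>\<^sub>0 Y" \<I>] by simp
  finally show "((\<one> X \<otimes> \<r> Y) \<cdot> \<a> X Y \<I>) \<otimes> \<one> \<I> = \<r> (X \<otimes>\<^sub>0 Y) \<otimes> \<one> \<I>"
    by (rule iso_cancel_left[OF Assoc_iso, rotated -1]) (use o in auto)
qed (use o in auto)

text \<open>
  The mirror image of \<open>RUnit_Assoc\<close>, from the pentagon for \<open>\<I>, \<I>, X, Y\<close>.
\<close>

lemma LUnit_Assoc:
  assumes o: "X \<in> Obj C" "Y \<in> Obj C"
  shows "\<l> (X \<otimes>\<^sub>0 Y) \<cdot> \<a> \<I> X Y = \<l> X \<otimes> \<one> Y"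
proof (rule Tensor_Unit_faithful_left)
  have iso: "is_iso C (\<a> \<I> (\<I> \<otimes>\<^sub>0 X) Y)"
    using o by (simp add: Assoc_iso)
  let ?u = "\<one> \<I> \<otimes> (\<l> (X \<otimes>\<^sub>0 Y) \<cdot> \<a> \<I> X Y)" and ?v = "\<one> \<I> \<otimes> (\<l> X \<otimes> \<one> Y)"
    and ?b = "inv_arr C (\<a> \<I> \<I> X) \<otimes> \<one> Y"
  have "?u \<cdot> \<a> \<I> (\<I> \<otimes>\<^sub>0 X) Y \<cdot> (\<a> \<I> \<I> X \<otimes> \<one> Y)
      = (\<one> \<I> \<otimes> \<l> (X \<otimes>\<^sub>0 Y))
        \<cdot> (\<one> \<I> \<otimes> \<a> \<I> X Y) \<cdot> \<a> \<I> (\<I> \<otimes>\<^sub>0 X) Y \<cdot> (\<a> \<I> \<I> X \<otimes> \<one> Y)"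
    using o by simp
  also have "\<dots> = (\<one> \<I> \<otimes> \<l> (X \<otimes>\<^sub>0 Y)) \<cdot> \<a> \<I> \<I> (X \<otimes>\<^sub>0 Y) \<cdot> \<a> (\<I> \<otimes>\<^sub>0 \<I>) X Y"
    unfolding pentagon[OF Unit_in_Obj Unit_in_Obj o] ..
  also have "\<dots> = ((\<one> \<I> \<otimes> \<l> (X \<otimes>\<^sub>0 Y)) \<cdot> \<a> \<I> \<I> (X \<otimes>\<^sub>0 Y)) \<cdot> \<a> (\<I> \<otimes>\<^sub>0 \<I>) X Y"
    using o by simp
  also have "\<dots> = (\<r> \<I> \<otimes> (\<one> X \<otimes> \<one> Y)) \<cdot> \<a> (\<I> \<otimes>\<^sub>0 \<I>) X Y"
    using o triangle[of \<I> "X \<otimes>\<^sub>0 Y"] by (simp del: Comp_assoc_arr)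
  also have "\<dots> = \<a> \<I> X Y \<cdot> ((\<r> \<I> \<otimes> \<one> X) \<otimes> \<one> Y)"
    using o by (subst Assoc_nat) auto
  also have "\<dots> = \<a> \<I> X Y \<cdot> ((\<one> \<I> \<otimes> \<l> X) \<otimes> \<one> Y) \<cdot> (\<a> \<I> \<I> X \<otimes> \<one> Y)"
    using o by (simp add: triangle)
  also have "\<dots> = ?v \<cdot> \<a> \<I> (\<I> \<otimes>\<^sub>0 X) Y \<cdot> (\<a> \<I> \<I> X \<otimes> \<one> Y)"
    using o by (subst Assoc_nat_Comp) auto
  finally have "(?u \<cdot> \<a> \<I> (\<I> \<otimes>\<^sub>0 X) Y \<cdot> (\<a> \<I> \<I> X \<otimes> \<one> Y)) \<cdot> ?b
      = (?v \<cdot> \<a> \<I> (\<I> \<otimes>\<^sub>0 X) Y \<cdot> (\<a> \<I> \<I> X \<otimes> \<one> Y)) \<cdot> ?b"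
    by simp
  then have "?u \<cdot> \<a> \<I> (\<I> \<otimes>\<^sub>0 X) Y = ?v \<cdot> \<a> \<I> (\<I> \<otimes>\<^sub>0 X) Y"
    using o by simp
  then show "?u = ?v"
    by (rule iso_cancel_right[OF iso, rotated -1]) (use o in auto)
qed (use o in auto)

lemma RUnit_Swap:
  assumes o: "X \<in> Obj C"
  shows "\<r> X \<cdot> \<s> \<I> X = \<l> X"
proof -
  have "\<r> X \<cdot> \<s> \<I> X = (\<l> X \<cdot> \<s> X \<I>) \<cdot> \<s> \<I> X"
    using Swap_unit[OF o] by simp
  also have "\<dots> = \<l> X \<cdot> \<s> X \<I> \<cdot> \<s> \<I> X"
    using o by simp
  finally show ?thesis
    using o by (simp add: Swap_Swap)
qed

lemma middle_swap_simps [simp]: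
  assumes "X \<in> Obj C" "X' \<in> Obj C" "Y \<in> Obj C" "Y' \<in> Obj C"
  shows "middle_swap C X X' Y Y' \<in> Arr C"
    "Dom C (middle_swap C X X' Y Y') = (X \<otimes>\<^sub>0 X') \<otimes>\<^sub>0 (Y \<otimes>\<^sub>0 Y')"
    "Cod C (middle_swap C X X' Y Y') = (X \<otimes>\<^sub>0 Y) \<otimes>\<^sub>0 (X' \<otimes>\<^sub>0 Y')"
  using assms by (auto simp: middle_swap_def)

lemma middle_swap_nat:
  assumes t: "f \<in> Arr C" "f' \<in> Arr C" "g \<in> Arr C" "g' \<in> Arr C"
    and d: "Dom C f = X" "Dom C f' = X'" "Dom C g = Y" "Dom C g' = Y'"
    and c: "Cod C f = W" "Cod C f' = W'" "Cod C g = Z" "Cod C g' = Z'"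
  shows "middle_swap C W W' Z Z' \<cdot> ((f \<otimes> f') \<otimes> (g \<otimes> g'))
    = ((f \<otimes> g) \<otimes> (f' \<otimes> g')) \<cdot> middle_swap C X X' Y Y'"
proof -
  have o: "X \<in> Obj C" "X' \<in> Obj C" "Y \<in> Obj C" "Y' \<in> Obj C"
    "W \<in> Obj C" "W' \<in> Obj C" "Z \<in> Obj C" "Z' \<in> Obj C"
    using t d c Dom_in_Obj Cod_in_Obj by auto
  let ?i = "\<lambda>X' Y Y'. \<a> Y X' Y' \<cdot> (\<s> X' Y \<otimes> \<one> Y') \<cdot> inv_arr C (\<a> X' Y Y')"
  have "?i W' Z Z' \<cdot> (f' \<otimes> (g \<otimes> g'))
      = \<a> Z W' Z' \<cdot> (\<s> W' Z \<otimes> \<one> Z') \<cdot> ((f' \<otimes> g) \<otimes> g') \<cdot> inv_arr C (\<a> X' Y Y')"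
    using t d c o by (simp add: Assoc_inv_nat)
  also have "\<dots> = \<a> Z W' Z' \<cdot> ((g \<otimes> f') \<otimes> g') \<cdot> (\<s> X' Y \<otimes> \<one> Y') \<cdot> inv_arr C (\<a> X' Y Y')"
    using t d c o by (simp add: Swap_nat)
  also have "\<dots> = (g \<otimes> (f' \<otimes> g')) \<cdot> ?i X' Y Y'"
    using t d c o by (subst Assoc_nat_Comp) auto
  finally have inner: "?i W' Z Z' \<cdot> (f' \<otimes> (g \<otimes> g')) = (g \<otimes> (f' \<otimes> g')) \<cdot> ?i X' Y Y'" .
  have "middle_swap C W W' Z Z' \<cdot> ((f \<otimes> f') \<otimes> (g \<otimes> g'))
      = inv_arr C (\<a> W Z (W' \<otimes>\<^sub>0 Z'))
        \<cdot> (\<one> W \<otimes> ?i W' Z Z') \<cdot> (f \<otimes> (f' \<otimes> (g \<otimes> g'))) \<cdot> \<a> X X' (Y \<otimes>\<^sub>0 Y')"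
    using t d c o by (simp add: middle_swap_def Assoc_nat)
  also have "\<dots> = inv_arr C (\<a> W Z (W' \<otimes>\<^sub>0 Z'))
        \<cdot> ((\<one> W \<cdot> f) \<otimes> (?i W' Z Z' \<cdot> (f' \<otimes> (g \<otimes> g')))) \<cdot> \<a> X X' (Y \<otimes>\<^sub>0 Y')"
    using t d c o by (subst interchange_Comp) auto
  also have "\<dots> = inv_arr C (\<a> W Z (W' \<otimes>\<^sub>0 Z'))
        \<cdot> (f \<otimes> (g \<otimes> (f' \<otimes> g'))) \<cdot> (\<one> X \<otimes> ?i X' Y Y') \<cdot> \<a> X X' (Y \<otimes>\<^sub>0 Y')"
    unfolding inner using t d c o by simp
  also have "\<dots> = (inv_arr C (\<a> W Z (W' \<otimes>\<^sub>0 Z'))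
        \<cdot> (f \<otimes> (g \<otimes> (f' \<otimes> g')))) \<cdot> (\<one> X \<otimes> ?i X' Y Y') \<cdot> \<a> X X' (Y \<otimes>\<^sub>0 Y')"
    by (rule Comp_assoc_arr[symmetric]) (use t d c o in auto)
  also have "\<dots> = ((f \<otimes> g) \<otimes> (f' \<otimes> g')) \<cdot> middle_swap C X X' Y Y'"
    using t d c o by (simp add: Assoc_inv_nat middle_swap_def)
  finally show ?thesis .
qed

lemma triangle_inv:
  assumes o: "X \<in> Obj C" "Y \<in> Obj C"
  shows "(\<r> X \<otimes> \<one> Y) \<cdot> inv_arr C (\<a> X \<I> Y) = \<one> X \<otimes> \<l> Y"
proof -
  have "(\<r> X \<otimes> \<one> Y) \<cdot> inv_arr C (\<a> X \<I> Y)
      = ((\<one> X \<otimes> \<l> Y) \<cdot> \<a> X \<I> Y) \<cdot> inv_arr C (\<a> X \<I> Y)"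
    using triangle[OF o] by simp
  then show ?thesis
    using o by simp
qed

lemma LUnit_Assoc_inv:
  assumes o: "X \<in> Obj C" "Y \<in> Obj C"
  shows "(\<l> X \<otimes> \<one> Y) \<cdot> inv_arr C (\<a> \<I> X Y) = \<l> (X \<otimes>\<^sub>0 Y)"
proof -
  have "(\<l> X \<otimes> \<one> Y) \<cdot> inv_arr C (\<a> \<I> X Y)
      = (\<l> (X \<otimes>\<^sub>0 Y) \<cdot> \<a> \<I> X Y) \<cdot> inv_arr C (\<a> \<I> X Y)"
    using LUnit_Assoc[OF o] by simp
  then show ?thesis
    using o by simp
qed

text \<open>
  Exchanging the inner factors of \<open>(X \<otimes> X) \<otimes> (\<I> \<otimes> \<I>)\<close> only moves a unit past \<open>X\<close>, so it is
  invisible once the units are removed. This is the coherence behind the determinism of the first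
  projection; \<open>LUnit_middle_swap\<close> plays the same part for the second.
\<close>

lemma RUnit_middle_swap:
  assumes o: "X \<in> Obj C"
  shows "(\<r> X \<otimes> \<r> X) \<cdot> middle_swap C X X \<I> \<I> = \<r> (X \<otimes>\<^sub>0 X) \<cdot> (\<one> (X \<otimes>\<^sub>0 X) \<otimes> \<l> \<I>)"
proof -
  let ?i = "\<a> \<I> X \<I> \<cdot> (\<s> X \<I> \<otimes> \<one> \<I>) \<cdot> inv_arr C (\<a> X \<I> \<I>)"
  have "\<r> X \<cdot> \<l> (X \<otimes>\<^sub>0 \<I>) \<cdot> ?i
      = \<r> X \<cdot> (\<l> (X \<otimes>\<^sub>0 \<I>) \<cdot> \<a> \<I> X \<I>) \<cdot> (\<s> X \<I> \<otimes> \<one> \<I>) \<cdot> inv_arr C (\<a> X \<I> \<I>)"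
    using o by simp
  also have "\<dots> = \<r> X \<cdot> (\<one> X \<otimes> \<l> \<I>)"
    unfolding LUnit_Assoc[OF o Unit_in_Obj] using o by (simp add: Swap_unit triangle_inv)
  finally have inner: "\<r> X \<cdot> \<l> (X \<otimes>\<^sub>0 \<I>) \<cdot> ?i = \<r> X \<cdot> (\<one> X \<otimes> \<l> \<I>)" .
  have "(\<r> X \<otimes> \<r> X) \<cdot> middle_swap C X X \<I> \<I>
      = (\<one> X \<otimes> \<r> X) \<cdot> ((\<r> X \<otimes> \<one> (X \<otimes>\<^sub>0 \<I>)) \<cdot> inv_arr C (\<a> X \<I> (X \<otimes>\<^sub>0 \<I>)))
        \<cdot> (\<one> X \<otimes> ?i) \<cdot> \<a> X X (\<I> \<otimes>\<^sub>0 \<I>)"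
    using o by (simp add: middle_swap_def)
  also have "\<dots> = (\<one> X \<otimes> (\<r> X \<cdot> \<l> (X \<otimes>\<^sub>0 \<I>) \<cdot> ?i)) \<cdot> \<a> X X (\<I> \<otimes>\<^sub>0 \<I>)"
    using o by (simp add: triangle_inv)
  also have "\<dots> = (\<one> X \<otimes> \<r> X) \<cdot> (\<one> X \<otimes> (\<one> X \<otimes> \<l> \<I>)) \<cdot> \<a> X X (\<I> \<otimes>\<^sub>0 \<I>)"
    unfolding inner using o by simp
  also have "\<dots> = (\<one> X \<otimes> \<r> X) \<cdot> \<a> X X \<I> \<cdot> ((\<one> X \<otimes> \<one> X) \<otimes> \<l> \<I>)"
    using o by (subst Assoc_nat) auto
  also have "\<dots> = ((\<one> X \<otimes> \<r> X) \<cdot> \<a> X X \<I>) \<cdot> ((\<one> X \<otimes> \<one> X) \<otimes> \<l> \<I>)"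
    by (rule Comp_assoc_arr[symmetric]) (use o in auto)
  also have "\<dots> = \<r> (X \<otimes>\<^sub>0 X) \<cdot> (\<one> (X \<otimes>\<^sub>0 X) \<otimes> \<l> \<I>)"
    unfolding RUnit_Assoc[OF o o] using o by simp
  finally show ?thesis .
qed

lemma LUnit_middle_swap:
  assumes o: "Y \<in> Obj C"
  shows "(\<l> Y \<otimes> \<l> Y) \<cdot> middle_swap C \<I> \<I> Y Y = \<l> (Y \<otimes>\<^sub>0 Y) \<cdot> (\<l> \<I> \<otimes> \<one> (Y \<otimes>\<^sub>0 Y))"
proof -
  let ?i = "\<a> Y \<I> Y \<cdot> (\<s> \<I> Y \<otimes> \<one> Y) \<cdot> inv_arr C (\<a> \<I> Y Y)"
  have "(\<one> Y \<otimes> \<l> Y) \<cdot> ?i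
      = ((\<one> Y \<otimes> \<l> Y) \<cdot> \<a> Y \<I> Y) \<cdot> (\<s> \<I> Y \<otimes> \<one> Y) \<cdot> inv_arr C (\<a> \<I> Y Y)"
    using o by simp
  also have "\<dots> = \<l> (Y \<otimes>\<^sub>0 Y)"
    unfolding triangle[OF o o] using o by (simp add: RUnit_Swap LUnit_Assoc_inv)
  finally have inner: "(\<one> Y \<otimes> \<l> Y) \<cdot> ?i = \<l> (Y \<otimes>\<^sub>0 Y)" .
  have "(\<l> Y \<otimes> \<l> Y) \<cdot> middle_swap C \<I> \<I> Y Y
      = (\<one> Y \<otimes> \<l> Y) \<cdot> ((\<l> Y \<otimes> \<one> (\<I> \<otimes>\<^sub>0 Y)) \<cdot> inv_arr C (\<a> \<I> Y (\<I> \<otimes>\<^sub>0 Y)))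
        \<cdot> (\<one> \<I> \<otimes> ?i) \<cdot> \<a> \<I> \<I> (Y \<otimes>\<^sub>0 Y)"
    using o by (simp add: middle_swap_def)
  also have "\<dots> = (\<one> Y \<otimes> \<l> Y) \<cdot> (\<l> (Y \<otimes>\<^sub>0 (\<I> \<otimes>\<^sub>0 Y)) \<cdot> (\<one> \<I> \<otimes> ?i)) \<cdot> \<a> \<I> \<I> (Y \<otimes>\<^sub>0 Y)"
    using o by (simp add: LUnit_Assoc_inv)
  also have "\<dots> = ((\<one> Y \<otimes> \<l> Y) \<cdot> ?i) \<cdot> \<l> (\<I> \<otimes>\<^sub>0 (Y \<otimes>\<^sub>0 Y)) \<cdot> \<a> \<I> \<I> (Y \<otimes>\<^sub>0 Y)"
    using o by (subst LUnit_nat) auto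
  also have "\<dots> = \<l> (Y \<otimes>\<^sub>0 Y) \<cdot> (\<l> \<I> \<otimes> \<one> (Y \<otimes>\<^sub>0 Y))"
    unfolding inner using o by (simp add: LUnit_Assoc)
  finally show ?thesis .
qed

end

section \<open>Projections in a Markov category\<close>

definition proj1 :: "('o, 'm, 'x) markov_data_scheme \<Rightarrow> 'o \<Rightarrow> 'o \<Rightarrow> 'm" where
  "proj1 C X Y = \<r>\<^bsub>C\<^esub> X \<cdot>\<^bsub>C\<^esub> (\<one>\<^bsub>C\<^esub> X \<otimes>\<^bsub>C\<^esub> del\<^bsub>C\<^esub> Y)"

definition proj2 :: "('o, 'm, 'x) markov_data_scheme \<Rightarrow> 'o \<Rightarrow> 'o \<Rightarrow> 'm" where
  "proj2 C X Y = \<l>\<^bsub>C\<^esub> Y \<cdot>\<^bsub>C\<^esub> (del\<^bsub>C\<^esub> X \<otimes>\<^bsub>C\<^esub> \<one>\<^bsub>C\<^esub> Y)"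

context markov_category
begin

lemma Copy_Del_simps [simp]:
  assumes "X \<in> Obj C"
  shows "copy X \<in> Arr C" "Dom C (copy X) = X" "Cod C (copy X) = X \<otimes>\<^sub>0 X"
    "del X \<in> Arr C" "Dom C (del X) = X" "Cod C (del X) = \<I>"
  using Copy_in_Hom[OF assms] Del_in_Hom[OF assms] by (auto simp: Hom_def)

lemma Del_Comp [simp]: "\<lbrakk>f \<in> Arr C; Cod C f = Y\<rbrakk> \<Longrightarrow> del Y \<cdot> f = del (Dom C f)"
  using Del_natural[of f "Dom C f" Y] by (simp add: Hom_def)

lemma Unit_terminal: "\<lbrakk>f \<in> Arr C; Cod C f = \<I>\<rbrakk> \<Longrightarrow> f = del (Dom C f)"
  using Del_Comp[of f \<I>] by (simp add: Del_Unit)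

lemma Swap_Unit_Unit: "\<s> \<I> \<I> = \<one> (\<I> \<otimes>\<^sub>0 \<I>)"
proof (rule iso_cancel_left)
  show "\<l> \<I> \<cdot> \<s> \<I> \<I> = \<l> \<I> \<cdot> \<one> (\<I> \<otimes>\<^sub>0 \<I>)"
    using Unit_terminal[of "\<l> \<I> \<cdot> \<s> \<I> \<I>"] Unit_terminal[of "\<l> \<I>"] by simp
qed (auto intro: LUnit_iso)

lemma proj_simps [simp]:
  assumes "X \<in> Obj C" "Y \<in> Obj C"
  shows "proj1 C X Y \<in> Arr C" "Dom C (proj1 C X Y) = X \<otimes>\<^sub>0 Y" "Cod C (proj1 C X Y) = X"
    "proj2 C X Y \<in> Arr C" "Dom C (proj2 C X Y) = X \<otimes>\<^sub>0 Y" "Cod C (proj2 C X Y) = Y"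
  using assms by (auto simp: proj1_def proj2_def)

lemma proj1_Tensor:
  assumes "f \<in> Arr C" "g \<in> Arr C" "Cod C f = X" "Cod C g = Y"
  shows "proj1 C X Y \<cdot> (f \<otimes> g) = f \<cdot> proj1 C (Dom C f) (Dom C g)"
proof -
  have o: "X \<in> Obj C" "Y \<in> Obj C" "Dom C f \<in> Obj C" "Dom C g \<in> Obj C"
    using assms Dom_in_Obj Cod_in_Obj by auto
  have "proj1 C X Y \<cdot> (f \<otimes> g) = (\<r> X \<cdot> (f \<otimes> \<one> \<I>)) \<cdot> (\<one> (Dom C f) \<otimes> del (Dom C g))"
    using assms o by (simp add: proj1_def)
  also have "\<dots> = f \<cdot> proj1 C (Dom C f) (Dom C g)"
    using assms o by (subst RUnit_nat) (auto simp: proj1_def)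
  finally show ?thesis .
qed

lemma proj2_Tensor:
  assumes "f \<in> Arr C" "g \<in> Arr C" "Cod C f = X" "Cod C g = Y"
  shows "proj2 C X Y \<cdot> (f \<otimes> g) = g \<cdot> proj2 C (Dom C f) (Dom C g)"
proof -
  have o: "X \<in> Obj C" "Y \<in> Obj C" "Dom C f \<in> Obj C" "Dom C g \<in> Obj C"
    using assms Dom_in_Obj Cod_in_Obj by auto
  have "proj2 C X Y \<cdot> (f \<otimes> g) = (\<l> Y \<cdot> (\<one> \<I> \<otimes> g)) \<cdot> (del (Dom C f) \<otimes> \<one> (Dom C g))"
    using assms o by (simp add: proj2_def)
  also have "\<dots> = g \<cdot> proj2 C (Dom C f) (Dom C g)"
    using assms o by (subst LUnit_nat) (auto simp: proj2_def)
  finally show ?thesis .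
qed

lemma proj_Copy:
  assumes "X \<in> Obj C"
  shows "proj1 C X X \<cdot> copy X = \<one> X" "proj2 C X X \<cdot> copy X = \<one> X"
  using assms Copy_Del_left Copy_Del_right by (auto simp: proj1_def proj2_def)

lemma proj_pair:
  assumes "f \<in> Arr C" "g \<in> Arr C" "Dom C f = A" "Dom C g = A" "Cod C f = X" "Cod C g = Y"
  shows "proj1 C X Y \<cdot> (f \<otimes> g) \<cdot> copy A = f" "proj2 C X Y \<cdot> (f \<otimes> g) \<cdot> copy A = g"
proof -
  have o: "X \<in> Obj C" "Y \<in> Obj C" "A \<in> Obj C"
    using assms Dom_in_Obj Cod_in_Obj by auto
  have "proj1 C X Y \<cdot> (f \<otimes> g) \<cdot> copy A = (proj1 C X Y \<cdot> (f \<otimes> g)) \<cdot> copy A"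
    "proj2 C X Y \<cdot> (f \<otimes> g) \<cdot> copy A = (proj2 C X Y \<cdot> (f \<otimes> g)) \<cdot> copy A"
    using assms o by auto
  then show "proj1 C X Y \<cdot> (f \<otimes> g) \<cdot> copy A = f" "proj2 C X Y \<cdot> (f \<otimes> g) \<cdot> copy A = g"
    unfolding proj1_Tensor[OF assms(1,2,5,6)] proj2_Tensor[OF assms(1,2,5,6)]
    using assms o by (simp_all add: proj_Copy)
qed

text \<open>
  Copying \<open>X \<otimes> Y\<close> and discarding \<open>Y\<close> in the first copy and \<open>X\<close> in the second amounts to copying
  each factor and discarding one of its copies. What remains of the middle exchange swaps \<open>\<I>\<close>
  with \<open>\<I>\<close>, and this is the identity because \<open>\<I>\<close> is terminal.
\<close>

lemma proj1_proj2_Copy: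
  assumes o: "X \<in> Obj C" "Y \<in> Obj C"
  shows "(proj1 C X Y \<otimes> proj2 C X Y) \<cdot> copy (X \<otimes>\<^sub>0 Y) = \<one> (X \<otimes>\<^sub>0 Y)"
proof -
  have "(proj1 C X Y \<otimes> proj2 C X Y) \<cdot> copy (X \<otimes>\<^sub>0 Y)
      = (\<r> X \<otimes> \<l> Y)
        \<cdot> (((\<one> X \<otimes> del Y) \<otimes> (del X \<otimes> \<one> Y)) \<cdot> middle_swap C X X Y Y) \<cdot> (copy X \<otimes> copy Y)"
    using o by (simp add: proj1_def proj2_def Copy_Tensor)
  also have "\<dots> = (\<r> X \<otimes> \<l> Y)
        \<cdot> (middle_swap C X \<I> \<I> Y \<cdot> ((\<one> X \<otimes> del X) \<otimes> (del Y \<otimes> \<one> Y))) \<cdot> (copy X \<otimes> copy Y)"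
    using o by (subst middle_swap_nat[symmetric]) auto
  also have "\<dots> = (\<r> X \<cdot> (\<one> X \<otimes> del X) \<cdot> copy X) \<otimes> (\<l> Y \<cdot> (del Y \<otimes> \<one> Y) \<cdot> copy Y)"
    using o by (simp add: middle_swap_def Swap_Unit_Unit)
  also have "\<dots> = \<one> (X \<otimes>\<^sub>0 Y)"
    using o by (simp only: Copy_Del_left Copy_Del_right Tensor_simps)
  finally show ?thesis .
qed

text \<open>
  The copy of the discarded factor contributes only an arrow into \<open>\<I>\<close>, so it can be replaced by
  a single discard.
\<close>

lemma deterministic_proj1:
  assumes o: "X \<in> Obj C" "Y \<in> Obj C"
  shows "deterministic C (proj1 C X Y)"
proof -
  have del: "\<l> \<I> \<cdot> (del Y \<otimes> del Y) \<cdot> copy Y = del Y"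
    using o Unit_terminal[of "\<l> \<I> \<cdot> (del Y \<otimes> del Y) \<cdot> copy Y"] by simp
  have "(proj1 C X Y \<otimes> proj1 C X Y) \<cdot> copy (X \<otimes>\<^sub>0 Y)
      = (\<r> X \<otimes> \<r> X)
        \<cdot> (((\<one> X \<otimes> del Y) \<otimes> (\<one> X \<otimes> del Y)) \<cdot> middle_swap C X X Y Y) \<cdot> (copy X \<otimes> copy Y)"
    using o by (simp add: proj1_def Copy_Tensor)
  also have "\<dots> = (\<r> X \<otimes> \<r> X)
        \<cdot> (middle_swap C X X \<I> \<I> \<cdot> ((\<one> X \<otimes> \<one> X) \<otimes> (del Y \<otimes> del Y))) \<cdot> (copy X \<otimes> copy Y)"
    using o by (subst middle_swap_nat[symmetric]) auto
  also have "\<dots> = ((\<r> X \<otimes> \<r> X) \<cdot> middle_swap C X X \<I> \<I>) \<cdot> (copy X \<otimes> ((del Y \<otimes> del Y) \<cdot> copy Y))"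
    using o by simp
  also have "\<dots> = \<r> (X \<otimes>\<^sub>0 X) \<cdot> (copy X \<otimes> (\<l> \<I> \<cdot> (del Y \<otimes> del Y) \<cdot> copy Y))"
    unfolding RUnit_middle_swap[OF o(1)] using o by simp
  also have "\<dots> = (\<r> (X \<otimes>\<^sub>0 X) \<cdot> (copy X \<otimes> \<one> \<I>)) \<cdot> (\<one> X \<otimes> del Y)"
    unfolding del using o by simp
  also have "\<dots> = copy X \<cdot> proj1 C X Y"
    using o by (subst RUnit_nat) (auto simp: proj1_def)
  finally show ?thesis
    using o by (simp add: deterministic_def)
qed

lemma deterministic_proj2:
  assumes o: "X \<in> Obj C" "Y \<in> Obj C"
  shows "deterministic C (proj2 C X Y)"
proof -
  have del: "\<l> \<I> \<cdot> (del X \<otimes> del X) \<cdot> copy X = del X"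
    using o Unit_terminal[of "\<l> \<I> \<cdot> (del X \<otimes> del X) \<cdot> copy X"] by simp
  have "(proj2 C X Y \<otimes> proj2 C X Y) \<cdot> copy (X \<otimes>\<^sub>0 Y)
      = (\<l> Y \<otimes> \<l> Y)
        \<cdot> (((del X \<otimes> \<one> Y) \<otimes> (del X \<otimes> \<one> Y)) \<cdot> middle_swap C X X Y Y) \<cdot> (copy X \<otimes> copy Y)"
    using o by (simp add: proj2_def Copy_Tensor)
  also have "\<dots> = (\<l> Y \<otimes> \<l> Y)
        \<cdot> (middle_swap C \<I> \<I> Y Y \<cdot> ((del X \<otimes> del X) \<otimes> (\<one> Y \<otimes> \<one> Y))) \<cdot> (copy X \<otimes> copy Y)"
    using o by (subst middle_swap_nat[symmetric]) auto
  also have "\<dots> = ((\<l> Y \<otimes> \<l> Y) \<cdot> middle_swap C \<I> \<I> Y Y) \<cdot> (((del X \<otimes> del X) \<cdot> copy X) \<otimes> copy Y)"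
    using o by simp
  also have "\<dots> = \<l> (Y \<otimes>\<^sub>0 Y) \<cdot> ((\<l> \<I> \<cdot> (del X \<otimes> del X) \<cdot> copy X) \<otimes> copy Y)"
    unfolding LUnit_middle_swap[OF o(2)] using o by simp
  also have "\<dots> = (\<l> (Y \<otimes>\<^sub>0 Y) \<cdot> (\<one> \<I> \<otimes> copy Y)) \<cdot> (del X \<otimes> \<one> Y)"
    unfolding del using o by simp
  also have "\<dots> = copy Y \<cdot> proj2 C X Y"
    using o by (subst LUnit_nat) (auto simp: proj2_def)
  finally show ?thesis
    using o by (simp add: deterministic_def)
qed

text \<open>
  Copying both copies gives four, and by coassociativity and cocommutativity the exchange of the
  inner two does not change them.
\<close>

lemma deterministic_Copy:
  assumes o: "X \<in> Obj C"
  shows "deterministic C (copy X)"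
proof -
  let ?c = "(\<one> X \<otimes> copy X) \<cdot> copy X"
  have inv: "inv_arr C (\<a> X X X) \<cdot> ?c = (copy X \<otimes> \<one> X) \<cdot> copy X"
    unfolding Copy_assoc[OF o, symmetric] using o by simp
  have "(\<a> X X X \<cdot> (\<s> X X \<otimes> \<one> X) \<cdot> inv_arr C (\<a> X X X)) \<cdot> ?c
      = \<a> X X X \<cdot> (\<s> X X \<otimes> \<one> X) \<cdot> inv_arr C (\<a> X X X) \<cdot> ?c"
    using o by simp
  also have "\<dots> = ?c"
    unfolding inv using o by (simp add: Copy_commute Copy_assoc)
  finally have swap: "(\<a> X X X \<cdot> (\<s> X X \<otimes> \<one> X) \<cdot> inv_arr C (\<a> X X X)) \<cdot> ?c = ?c" .
  \<comment> \<open>the four copies, bracketed so that the inner two are the first two of \<open>?c\<close>\<close>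
  have four: "\<a> X X (X \<otimes>\<^sub>0 X) \<cdot> (copy X \<otimes> copy X) \<cdot> copy X = (\<one> X \<otimes> ?c) \<cdot> copy X"
  proof -
    have "\<a> X X (X \<otimes>\<^sub>0 X) \<cdot> (copy X \<otimes> copy X) \<cdot> copy X
        = \<a> X X (X \<otimes>\<^sub>0 X) \<cdot> ((\<one> X \<otimes> \<one> X) \<otimes> copy X) \<cdot> (copy X \<otimes> \<one> X) \<cdot> copy X"
      using o by simp
    also have "\<dots> = (\<one> X \<otimes> (\<one> X \<otimes> copy X)) \<cdot> \<a> X X X \<cdot> (copy X \<otimes> \<one> X) \<cdot> copy X"
      using o by (subst Assoc_nat_Comp) auto
    also have "\<dots> = (\<one> X \<otimes> ?c) \<cdot> copy X"
      unfolding Copy_assoc[OF o] using o by simp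
    finally show ?thesis .
  qed
  have "copy (X \<otimes>\<^sub>0 X) \<cdot> copy X = inv_arr C (\<a> X X (X \<otimes>\<^sub>0 X))
      \<cdot> (\<one> X \<otimes> (\<a> X X X \<cdot> (\<s> X X \<otimes> \<one> X) \<cdot> inv_arr C (\<a> X X X)))
      \<cdot> \<a> X X (X \<otimes>\<^sub>0 X) \<cdot> (copy X \<otimes> copy X) \<cdot> copy X"
    using o by (simp add: Copy_Tensor middle_swap_def)
  also have "\<dots> = inv_arr C (\<a> X X (X \<otimes>\<^sub>0 X))
      \<cdot> ((\<one> X \<cdot> \<one> X) \<otimes> ((\<a> X X X \<cdot> (\<s> X X \<otimes> \<one> X) \<cdot> inv_arr C (\<a> X X X)) \<cdot> ?c)) \<cdot> copy X"
    unfolding four using o by (subst interchange_Comp) auto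
  also have "\<dots> = inv_arr C (\<a> X X (X \<otimes>\<^sub>0 X)) \<cdot> \<a> X X (X \<otimes>\<^sub>0 X) \<cdot> (copy X \<otimes> copy X) \<cdot> copy X"
    unfolding swap four using o by simp
  also have "\<dots> = (copy X \<otimes> copy X) \<cdot> copy X"
    using o by simp
  finally show ?thesis
    using o by (simp add: deterministic_def)
qed

end

section \<open>Conditionals and almost sure equality\<close>

text \<open>
  Given \<open>u : A \<rightarrow> X\<close> and \<open>k : X \<otimes> A \<rightarrow> Y\<close>, this draws \<open>x\<close> from \<open>u\<close>, then \<open>y\<close> from \<open>k\<close> at \<open>x\<close> and
  the input, and returns both. A conditional of an arrow is a \<open>k\<close> that recovers it from its
  marginal in this way.
\<close>

definition extend :: "('o, 'm, 'x) markov_data_scheme \<Rightarrow> 'o \<Rightarrow> 'o \<Rightarrow> 'm \<Rightarrow> 'm \<Rightarrow> 'm" where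
  "extend C A X k u = (\<one>\<^bsub>C\<^esub> X \<otimes>\<^bsub>C\<^esub> k) \<cdot>\<^bsub>C\<^esub> \<a>\<^bsub>C\<^esub> X X A
    \<cdot>\<^bsub>C\<^esub> (copy\<^bsub>C\<^esub> X \<otimes>\<^bsub>C\<^esub> \<one>\<^bsub>C\<^esub> A) \<cdot>\<^bsub>C\<^esub> (u \<otimes>\<^bsub>C\<^esub> \<one>\<^bsub>C\<^esub> A) \<cdot>\<^bsub>C\<^esub> copy\<^bsub>C\<^esub> A"

context markov_category
begin

lemma extend_simps [simp]:
  assumes "u \<in> Hom C A X" "k \<in> Hom C (X \<otimes>\<^sub>0 A) Y"
  shows "extend C A X k u \<in> Arr C" "Dom C (extend C A X k u) = A"
    "Cod C (extend C A X k u) = X \<otimes>\<^sub>0 Y"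
  using assms Hom_D[OF assms(1)] Hom_D[OF assms(2)] by (auto simp: extend_def Hom_def)

lemma has_conditionals_extend:
  assumes "has_conditionals C" "f \<in> Hom C A (X \<otimes>\<^sub>0 Y)" "X \<in> Obj C" "Y \<in> Obj C"
  obtains k where "k \<in> Hom C (X \<otimes>\<^sub>0 A) Y" "f = extend C A X k (proj1 C X Y \<cdot> f)"
proof -
  have A: "A \<in> Obj C"
    using assms(2) Hom_D by blast
  obtain k where k: "is_conditional C A X Y f k"
    using assms A unfolding has_conditionals_def by blast
  have "marginal C X Y f = proj1 C X Y \<cdot> f"
    using assms by (simp add: marginal_def proj1_def Hom_def)
  then show thesis
    using k that[of k] by (simp only: is_conditional_def extend_def)
qed

text \<open>
  If the kernel looks at \<open>x\<close> only through \<open>n x\<close>, then applying \<open>n\<close> to the returned \<open>x\<close> gives the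
  same as drawing \<open>n x\<close> in the first place, because a deterministic \<open>n\<close> may be applied before
  copying instead of to each copy.
\<close>

lemma Tensor_deterministic_extend:
  assumes u: "u \<in> Hom C A X" and k: "k \<in> Hom C (Z \<otimes>\<^sub>0 A) Y"
    and n: "n \<in> Hom C X Z" "deterministic C n"
  shows "(n \<otimes> \<one> Y) \<cdot> extend C A X (k \<cdot> (n \<otimes> \<one> A)) u = extend C A Z k (n \<cdot> u)"
proof -
  have o: "A \<in> Obj C" "X \<in> Obj C" "Y \<in> Obj C" "Z \<in> Obj C"
    using Hom_D u k n by auto
  note t = u[unfolded Hom_def] k[unfolded Hom_def] n(1)[unfolded Hom_def]
  have det: "copy Z \<cdot> n = (n \<otimes> n) \<cdot> copy X"
    using n Hom_D[OF n(1)] by (simp add: deterministic_def)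
  have "extend C A Z k (n \<cdot> u) = (\<one> Z \<otimes> k) \<cdot> \<a> Z Z A \<cdot> (((copy Z \<cdot> n) \<cdot> u) \<otimes> \<one> A) \<cdot> copy A"
    using t o by (simp add: extend_def)
  also have "\<dots> = (\<one> Z \<otimes> k) \<cdot> \<a> Z Z A \<cdot> ((n \<otimes> n) \<otimes> \<one> A) \<cdot> ((copy X \<cdot> u) \<otimes> \<one> A) \<cdot> copy A"
    unfolding det using t o by simp
  also have "\<dots> = (\<one> Z \<otimes> k) \<cdot> (n \<otimes> (n \<otimes> \<one> A)) \<cdot> \<a> X X A \<cdot> ((copy X \<cdot> u) \<otimes> \<one> A) \<cdot> copy A"
    using t o by (subst Assoc_nat_Comp) auto
  also have "\<dots> = (n \<otimes> \<one> Y) \<cdot> extend C A X (k \<cdot> (n \<otimes> \<one> A)) u"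
    using t o by (simp add: extend_def)
  finally show ?thesis ..
qed

lemma proj1_extend:
  assumes u: "u \<in> Hom C A X" and k: "k \<in> Hom C (X \<otimes>\<^sub>0 A) Y"
  shows "proj1 C X Y \<cdot> extend C A X k u = u"
proof -
  have o: "A \<in> Obj C" "X \<in> Obj C" "Y \<in> Obj C"
    using Hom_D u k by auto
  note t = u[unfolded Hom_def] k[unfolded Hom_def]
  have "proj1 C X Y \<cdot> extend C A X k u
      = \<r> X \<cdot> (\<one> X \<otimes> del (X \<otimes>\<^sub>0 A)) \<cdot> \<a> X X A \<cdot> ((copy X \<cdot> u) \<otimes> \<one> A) \<cdot> copy A"
    using t o by (simp add: extend_def proj1_def)
  also have "\<dots> = \<r> X \<cdot> (\<one> X \<otimes> \<l> \<I>)
      \<cdot> (\<one> X \<otimes> (del X \<otimes> del A)) \<cdot> \<a> X X A \<cdot> ((copy X \<cdot> u) \<otimes> \<one> A) \<cdot> copy A"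
    using t o by (simp add: Del_Tensor)
  also have "\<dots> = \<r> X \<cdot> (\<one> X \<otimes> \<l> \<I>)
      \<cdot> \<a> X \<I> \<I> \<cdot> ((\<one> X \<otimes> del X) \<otimes> del A) \<cdot> ((copy X \<cdot> u) \<otimes> \<one> A) \<cdot> copy A"
    using t o by (subst Assoc_nat_Comp) auto
  also have "\<dots> = \<r> X \<cdot> ((\<one> X \<otimes> \<l> \<I>) \<cdot> \<a> X \<I> \<I>)
      \<cdot> ((\<one> X \<otimes> del X) \<otimes> del A) \<cdot> ((copy X \<cdot> u) \<otimes> \<one> A) \<cdot> copy A"
    using t o by simp
  also have "\<dots> = \<r> X \<cdot> (((\<r> X \<cdot> (\<one> X \<otimes> del X) \<cdot> copy X) \<cdot> u) \<otimes> del A) \<cdot> copy A"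
    unfolding triangle[OF o(2) Unit_in_Obj] using t o by simp
  also have "\<dots> = \<r> X \<cdot> (u \<otimes> del A) \<cdot> copy A"
    unfolding Copy_Del_right[OF o(2)] using t by simp
  also have "\<dots> = proj1 C X A \<cdot> (u \<otimes> \<one> A) \<cdot> copy A"
    using t o by (simp add: proj1_def)
  also have "\<dots> = u"
    using t o by (intro proj_pair) auto
  finally show ?thesis .
qed

text \<open>
  Let \<open>x\<close> be drawn from \<open>p\<close> and condition \<open>x\<close> on the pair \<open>(f x, g x)\<close>. As this pair has the form
  \<open>(y, y)\<close>, the joint arrow of \<open>((f x, g x), x)\<close> is also that of \<open>((y, y), x)\<close> with \<open>x\<close>
  drawn given \<open>y\<close> and the input of \<open>p\<close>. Forgetting either copy of \<open>y\<close> has the same effect, so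
  \<open>(f x, x)\<close> and \<open>(g x, x)\<close> have the same joint arrow.
\<close>

lemma as_equal_if_diagonal:
  assumes cond: "has_conditionals C" and p: "p \<in> Hom C A X"
    and f: "f \<in> Hom C X Y" and g: "g \<in> Hom C X Y"
    and diag: "(f \<otimes> g) \<cdot> copy X \<cdot> p = copy Y \<cdot> y" and y: "y \<in> Hom C A Y"
  shows "as_equal C p f g"
proof -
  have o: "A \<in> Obj C" "X \<in> Obj C" "Y \<in> Obj C"
    using Hom_D p f by auto
  note t = p[unfolded Hom_def] f[unfolded Hom_def] g[unfolded Hom_def] y[unfolded Hom_def]
  \<comment> \<open>the joint arrow of \<open>((f x, g x), x)\<close>\<close>
  let ?F = "(((f \<otimes> g) \<cdot> copy X) \<otimes> \<one> X) \<cdot> copy X \<cdot> p"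
  have F: "?F \<in> Hom C A ((Y \<otimes>\<^sub>0 Y) \<otimes>\<^sub>0 X)"
    using t o by (simp add: Hom_def)
  obtain k where k: "k \<in> Hom C ((Y \<otimes>\<^sub>0 Y) \<otimes>\<^sub>0 A) X"
    and Fk: "?F = extend C A (Y \<otimes>\<^sub>0 Y) k (proj1 C (Y \<otimes>\<^sub>0 Y) X \<cdot> ?F)"
    using has_conditionals_extend[OF cond F] o by auto
  let ?k = "k \<cdot> (copy Y \<otimes> \<one> A)"
  have k': "?k \<in> Hom C (Y \<otimes>\<^sub>0 A) X"
    using k o by (simp add: Hom_def)
  have marg: "proj1 C (Y \<otimes>\<^sub>0 Y) X \<cdot> ?F = copy Y \<cdot> y"
  proof -
    have "proj1 C (Y \<otimes>\<^sub>0 Y) X \<cdot> ?F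
        = (proj1 C (Y \<otimes>\<^sub>0 Y) X \<cdot> (((f \<otimes> g) \<cdot> copy X) \<otimes> \<one> X) \<cdot> copy X) \<cdot> p"
      using t o by simp
    also have "\<dots> = ((f \<otimes> g) \<cdot> copy X) \<cdot> p"
      using t o by (subst proj_pair(1)) auto
    also have "\<dots> = copy Y \<cdot> y"
      using t o diag by simp
    finally show ?thesis .
  qed
  have F_diag: "?F = (copy Y \<otimes> \<one> X) \<cdot> extend C A Y ?k y"
    using Fk Tensor_deterministic_extend[OF y k Copy_in_Hom deterministic_Copy] o by (simp add: marg)
  have e: "extend C A Y ?k y \<in> Arr C" "Dom C (extend C A Y ?k y) = A"
    "Cod C (extend C A Y ?k y) = Y \<otimes>\<^sub>0 X"
    using extend_simps[OF y k'] by auto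
  have "(f \<otimes> \<one> X) \<cdot> copy X \<cdot> p = (proj1 C Y Y \<otimes> \<one> X) \<cdot> ?F"
    using t o by (simp add: proj_pair)
  also have "\<dots> = extend C A Y ?k y"
    unfolding F_diag using e o by (simp add: proj_Copy)
  also have "\<dots> = (proj2 C Y Y \<otimes> \<one> X) \<cdot> ?F"
    unfolding F_diag using e o by (simp add: proj_Copy)
  also have "\<dots> = (g \<otimes> \<one> X) \<cdot> copy X \<cdot> p"
    using t o by (simp add: proj_pair)
  finally have eq: "(f \<otimes> \<one> X) \<cdot> copy X \<cdot> p = (g \<otimes> \<one> X) \<cdot> copy X \<cdot> p" .
  \<comment> \<open>\<open>as_equal\<close> keeps \<open>x\<close> on the left, whereas \<open>eq\<close> has it on the right\<close>
  have swap: "(\<one> X \<otimes> v) \<cdot> copy X \<cdot> p = \<s> Y X \<cdot> (v \<otimes> \<one> X) \<cdot> copy X \<cdot> p"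
    if v: "v \<in> Arr C" "Dom C v = X" "Cod C v = Y" for v
  proof -
    have "\<s> Y X \<cdot> (v \<otimes> \<one> X) \<cdot> copy X \<cdot> p = (\<s> Y X \<cdot> (v \<otimes> \<one> X)) \<cdot> copy X \<cdot> p"
      using v t o by simp
    also have "\<dots> = (\<one> X \<otimes> v) \<cdot> (\<s> X X \<cdot> copy X) \<cdot> p"
      using v t o by (subst Swap_nat) auto
    finally show ?thesis
      using o by (simp add: Copy_commute)
  qed
  show ?thesis
    using t by (simp add: as_equal_def swap eq)
qed

section \<open>Couplings and lifts\<close>

text \<open>
  With \<open>k\<close> the conditional of \<open>q\<close> given the image under \<open>m\<close>, the coupling \<open>h\<close> draws \<open>b'\<close>
  from \<open>p\<close> and feeds \<open>n b'\<close> into \<open>k\<close>. By the naturality of \<open>extend\<close>, the image of \<open>h\<close> under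
  \<open>n \<otimes> \<one>\<close> is the joint arrow of \<open>(m b, b)\<close> for \<open>b\<close> drawn from \<open>q\<close>, from which the second
  marginal of \<open>h\<close> and its image under \<open>n \<otimes> m\<close> can be read off.
\<close>

lemma coupling_over:
  assumes cond: "has_conditionals C"
    and q: "q \<in> Hom C S B" and p: "p \<in> Hom C S B'"
    and m: "m \<in> Hom C B D" "deterministic C m" and n: "n \<in> Hom C B' D" "deterministic C n"
    and eq: "m \<cdot> q = n \<cdot> p"
  obtains h where "h \<in> Hom C S (B' \<otimes>\<^sub>0 B)" "proj1 C B' B \<cdot> h = p" "proj2 C B' B \<cdot> h = q"
    "(n \<otimes> m) \<cdot> h = copy D \<cdot> m \<cdot> q"
proof -
  have o: "S \<in> Obj C" "B \<in> Obj C" "B' \<in> Obj C" "D \<in> Obj C"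
    using Hom_D q p m by auto
  note t = q[unfolded Hom_def] p[unfolded Hom_def] m(1)[unfolded Hom_def] n(1)[unfolded Hom_def]
  \<comment> \<open>the joint arrow of \<open>(m b, b)\<close>\<close>
  let ?F = "(m \<otimes> \<one> B) \<cdot> copy B \<cdot> q"
  have F: "?F \<in> Hom C S (D \<otimes>\<^sub>0 B)"
    using t o by (simp add: Hom_def)
  have proj_F: "proj1 C D B \<cdot> ?F = m \<cdot> q" "proj2 C D B \<cdot> ?F = q"
  proof -
    have "proj1 C D B \<cdot> ?F = (proj1 C D B \<cdot> (m \<otimes> \<one> B) \<cdot> copy B) \<cdot> q"
      "proj2 C D B \<cdot> ?F = (proj2 C D B \<cdot> (m \<otimes> \<one> B) \<cdot> copy B) \<cdot> q"
      using t o by auto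
    then show "proj1 C D B \<cdot> ?F = m \<cdot> q" "proj2 C D B \<cdot> ?F = q"
      using proj_pair[of m "\<one> B" B D B] t o by (auto simp del: Comp_assoc_arr)
  qed
  obtain k where k: "k \<in> Hom C (D \<otimes>\<^sub>0 S) B" and Fk: "?F = extend C S D k (m \<cdot> q)"
    using has_conditionals_extend[OF cond F o(4,2)] by (auto simp: proj_F)
  define h where "h = extend C S B' (k \<cdot> (n \<otimes> \<one> S)) p"
  have k': "k \<cdot> (n \<otimes> \<one> S) \<in> Hom C (B' \<otimes>\<^sub>0 S) B"
    using k t o by (simp add: Hom_def)
  have h: "h \<in> Arr C" "Dom C h = S" "Cod C h = B' \<otimes>\<^sub>0 B"
    unfolding h_def using extend_simps[OF p k'] by auto
  have nh: "(n \<otimes> \<one> B) \<cdot> h = ?F"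
    unfolding h_def Fk eq by (rule Tensor_deterministic_extend[OF p k n])
  show thesis
  proof
    show "h \<in> Hom C S (B' \<otimes>\<^sub>0 B)"
      using h by (simp add: Hom_def)
    show "proj1 C B' B \<cdot> h = p"
      unfolding h_def by (rule proj1_extend[OF p k'])
    have "proj2 C B' B \<cdot> h = (proj2 C D B \<cdot> (n \<otimes> \<one> B)) \<cdot> h"
      using t o h by (subst proj2_Tensor) auto
    also have "\<dots> = proj2 C D B \<cdot> (n \<otimes> \<one> B) \<cdot> h"
      using t o h by simp
    finally show "proj2 C B' B \<cdot> h = q"
      by (simp only: nh proj_F)
    have "(n \<otimes> m) \<cdot> h = (\<one> D \<otimes> m) \<cdot> (n \<otimes> \<one> B) \<cdot> h"
      using t o h by simp
    also have "\<dots> = ((m \<otimes> m) \<cdot> copy B) \<cdot> q"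
      unfolding nh using t o by simp
    also have "\<dots> = (copy D \<cdot> m) \<cdot> q"
      using m(2) t by (simp add: deterministic_def del: Comp_assoc_arr)
    finally show "(n \<otimes> m) \<cdot> h = copy D \<cdot> m \<cdot> q"
      using t o by simp
  qed
qed

text \<open>
  The lifting property of a weak pullback of deterministic arrows extends to arrows that are not
  deterministic: the coupling is supported on the equalizer, and there the property for
  deterministic arrows applies to the projections.
\<close>

lemma weak_pullback_lift:
  assumes cond: "has_conditionals C" and ep: "equalizer_principle C"
    and wpb: "weak_pullback (det_cat C) f g m n"
    and m: "m \<in> Hom C B D" and n: "n \<in> Hom C B' D"
    and q: "q \<in> Hom C S B" and p: "p \<in> Hom C S B'" and eq: "m \<cdot> q = n \<cdot> p"
  obtains r where "r \<in> Hom C S (Dom C f)" "f \<cdot> r = q" "g \<cdot> r = p"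
proof -
  have o: "S \<in> Obj C" "B \<in> Obj C" "B' \<in> Obj C" "D \<in> Obj C"
    using Hom_D q p m by auto
  obtain A where f: "f \<in> Hom C A B" and g: "g \<in> Hom C A B'"
    and det: "deterministic C m" "deterministic C n"
    and lift: "\<And>T q' p'. \<lbrakk>T \<in> Obj C; q' \<in> Hom (det_cat C) T B; p' \<in> Hom (det_cat C) T B';
      m \<cdot> q' = n \<cdot> p'\<rbrakk> \<Longrightarrow> \<exists>r \<in> Hom (det_cat C) T A. f \<cdot> r = q' \<and> g \<cdot> r = p'"
  proof -
    obtain A B1 B2 D1 where w: "f \<in> Hom (det_cat C) A B1" "g \<in> Hom (det_cat C) A B2"
      "m \<in> Hom (det_cat C) B1 D1" "n \<in> Hom (det_cat C) B2 D1"
      "\<forall>S \<in> Obj C. \<forall>q \<in> Hom (det_cat C) S B1. \<forall>p \<in> Hom (det_cat C) S B2. m \<cdot> q = n \<cdot> p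
        \<longrightarrow> (\<exists>r \<in> Hom (det_cat C) S A. f \<cdot> r = q \<and> g \<cdot> r = p)"
      using wpb unfolding weak_pullback_def det_cat_simps by blast
    moreover have "B1 = B" "B2 = B'"
      using w(3,4) m n by (auto simp: Hom_def)
    ultimately show thesis
      using that[of A] by (simp add: Hom_det_cat)
  qed
  note t = q[unfolded Hom_def] p[unfolded Hom_def] m[unfolded Hom_def] n[unfolded Hom_def]
    f[unfolded Hom_def] g[unfolded Hom_def]
  obtain h where h: "h \<in> Hom C S (B' \<otimes>\<^sub>0 B)"
    and marg: "proj1 C B' B \<cdot> h = p" "proj2 C B' B \<cdot> h = q"
    and diag: "(n \<otimes> m) \<cdot> h = copy D \<cdot> m \<cdot> q"
    using coupling_over[OF cond q p m det(1) n det(2) eq] .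
  let ?u = "n \<cdot> proj1 C B' B" and ?v = "m \<cdot> proj2 C B' B"
  have proj: "proj1 C B' B \<in> Hom C (B' \<otimes>\<^sub>0 B) B'" "proj2 C B' B \<in> Hom C (B' \<otimes>\<^sub>0 B) B"
    using o by (auto simp: Hom_def)
  have uv: "?u \<in> Hom C (B' \<otimes>\<^sub>0 B) D" "?v \<in> Hom C (B' \<otimes>\<^sub>0 B) D"
    using t o by (auto simp: Hom_def)
  have uv_det: "deterministic C ?u" "deterministic C ?v"
    using deterministic_Comp[OF proj(1) deterministic_proj1 n det(2)]
      deterministic_Comp[OF proj(2) deterministic_proj2 m det(1)] o by auto
  \<comment> \<open>pairing the projections is the identity, so \<open>(?u, ?v)\<close> is distributed as \<open>(n \<otimes> m) \<cdot> h\<close>\<close>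
  have "(?u \<otimes> ?v) \<cdot> copy (B' \<otimes>\<^sub>0 B) \<cdot> h
      = (n \<otimes> m) \<cdot> ((proj1 C B' B \<otimes> proj2 C B' B) \<cdot> copy (B' \<otimes>\<^sub>0 B)) \<cdot> h"
    using t o h by (simp add: Hom_def)
  also have "\<dots> = copy D \<cdot> m \<cdot> q"
    using h o diag by (simp add: proj1_proj2_Copy Hom_def)
  finally have "as_equal C h ?u ?v"
    using as_equal_if_diagonal[OF cond h uv] Comp_in_Hom[OF q m] by blast
  moreover obtain e where e: "is_equalizer (det_cat C) ?u ?v e"
    using ep uv uv_det o unfolding equalizer_principle_def has_equalizers_def
    by (metis Hom_det_cat Tensor0_in_Obj det_cat_simps(1))
  moreover obtain E where eE: "e \<in> Hom C E (B' \<otimes>\<^sub>0 B)" "deterministic C e" "?u \<cdot> e = ?v \<cdot> e"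
    using e uv unfolding is_equalizer_def by (auto simp: Hom_det_cat) (auto simp: Hom_def)
  ultimately obtain h' where h': "h' \<in> Hom C S E" "e \<cdot> h' = h"
    using ep h o(1) unfolding equalizer_principle_def by (metis Hom_D)
  have te: "e \<in> Arr C" "Dom C e = E" "Cod C e = B' \<otimes>\<^sub>0 B" "h' \<in> Arr C" "Dom C h' = S" "Cod C h' = E"
    using eE h' by (auto simp: Hom_def)
  have "proj2 C B' B \<cdot> e \<in> Hom (det_cat C) E B" "proj1 C B' B \<cdot> e \<in> Hom (det_cat C) E B'"
    using Comp_in_Hom[OF eE(1) proj(1)] Comp_in_Hom[OF eE(1) proj(2)]
      deterministic_Comp[OF eE(1,2) proj(1) deterministic_proj1]
      deterministic_Comp[OF eE(1,2) proj(2) deterministic_proj2] o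
    by (auto simp: Hom_det_cat)
  moreover have "m \<cdot> proj2 C B' B \<cdot> e = n \<cdot> proj1 C B' B \<cdot> e"
    using eE(3) te t o by simp
  moreover have "E \<in> Obj C"
    using Hom_D[OF eE(1)] by blast
  ultimately obtain w where w: "w \<in> Hom C E A"
    "f \<cdot> w = proj2 C B' B \<cdot> e" "g \<cdot> w = proj1 C B' B \<cdot> e"
    using lift by (metis Hom_det_cat)
  show thesis
  proof
    show "w \<cdot> h' \<in> Hom C S (Dom C f)"
      using w(1) te t by (simp add: Hom_def)
    have "f \<cdot> w \<cdot> h' = (f \<cdot> w) \<cdot> h'" "g \<cdot> w \<cdot> h' = (g \<cdot> w) \<cdot> h'"
      using w(1) te t by (simp_all add: Hom_def)
    then show "f \<cdot> w \<cdot> h' = q" "g \<cdot> w \<cdot> h' = p"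
      using w te o by (simp_all add: h'(2) marg)
  qed
qed

text \<open>
  Naturality of the bijection between deterministic arrows \<open>S \<rightarrow> P X\<close> and arrows \<open>S \<rightarrow> X\<close>.
\<close>

lemma dist_map_samp_eq:
  assumes P: "distribution_objects C P samp" and f: "f \<in> Hom C X Y"
    and a: "a \<in> Hom (det_cat C) S (P X)" and b: "b \<in> Hom (det_cat C) S (P Y)"
  shows "dist_map C P samp f \<cdot> a = b \<longleftrightarrow> f \<cdot> samp X \<cdot> a = samp Y \<cdot> b"
proof -
  interpret D: category "det_cat C" by (rule category_det_cat)
  have s: "samp X \<in> Hom C (P X) X" "samp Y \<in> Hom C (P Y) Y"
    using samp_in_Hom[OF P] Hom_D[OF f] by auto
  have F: "dist_map C P samp f \<in> Hom C (P X) (P Y)" and a': "a \<in> Hom C S (P X)"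
    using dist_map(1)[OF P f] a by (auto simp: Hom_det_cat)
  have Fa: "dist_map C P samp f \<cdot> a \<in> Hom (det_cat C) S (P Y)"
    using D.Comp_in_Hom[OF a dist_map(1)[OF P f]] by simp
  have "samp Y \<cdot> dist_map C P samp f \<cdot> a = (samp Y \<cdot> dist_map C P samp f) \<cdot> a"
    using Comp_assoc[OF a' F s(2)] by simp
  also have "\<dots> = f \<cdot> samp X \<cdot> a"
    using dist_map(2)[OF P f] Comp_assoc[OF a' s(1) f] by simp
  finally have flat: "samp Y \<cdot> dist_map C P samp f \<cdot> a = f \<cdot> samp X \<cdot> a" .
  have "samp Y \<cdot> b \<in> Hom C S Y"
    using Comp_in_Hom[OF _ s(2)] b by (simp add: Hom_det_cat)
  then show ?thesis
    using sharp(3)[OF P _ Fa] sharp(3)[OF P _ b] flat by metis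
qed

end

theorem theorem3p7:
  fixes C :: "('o, 'm, 'x) markov_data_scheme"
    and P :: "'o \<Rightarrow> 'o" and samp :: "'o \<Rightarrow> 'm"
  assumes "markov_category C"
    and "distribution_objects C P samp"
    and "has_conditionals C"
    and "equalizer_principle C"
  shows "preserves_weak_pullbacks (det_cat C) (det_cat C) (dist_map C P samp)"
  unfolding preserves_weak_pullbacks_def
proof (intro allI impI)
  fix f g m n
  assume wpb: "weak_pullback (det_cat C) f g m n"
  interpret markov_category C by fact
  interpret F: cat_functor "det_cat C" "det_cat C" P "dist_map C P samp"
    by (rule functor_dist_map_det) fact
  note P = assms(2)
  let ?F = "dist_map C P samp"
  obtain A B B' D where f: "f \<in> Hom (det_cat C) A B" and g: "g \<in> Hom (det_cat C) A B'"
    and m: "m \<in> Hom (det_cat C) B D" and n: "n \<in> Hom (det_cat C) B' D"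
    and comm: "m \<cdot>\<^bsub>C\<^esub> f = n \<cdot>\<^bsub>C\<^esub> g"
    using wpb unfolding weak_pullback_def by auto
  note t = f[unfolded Hom_det_cat] g[unfolded Hom_det_cat] m[unfolded Hom_det_cat] n[unfolded Hom_det_cat]
  have o: "A \<in> Obj C" "B \<in> Obj C" "B' \<in> Obj C" "D \<in> Obj C"
    using Hom_D t by auto
  have "?F m \<cdot>\<^bsub>C\<^esub> ?F f = ?F n \<cdot>\<^bsub>C\<^esub> ?F g"
    using F.maps_Comp[OF f m] F.maps_Comp[OF g n] comm by simp
  moreover have "\<exists>r \<in> Hom (det_cat C) S (P A). ?F f \<cdot>\<^bsub>C\<^esub> r = q \<and> ?F g \<cdot>\<^bsub>C\<^esub> r = p"
    if q: "q \<in> Hom (det_cat C) S (P B)" and p: "p \<in> Hom (det_cat C) S (P B')"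
      and eq: "?F m \<cdot>\<^bsub>C\<^esub> q = ?F n \<cdot>\<^bsub>C\<^esub> p" for S q p
  proof -
    have fl: "samp B \<cdot>\<^bsub>C\<^esub> q \<in> Hom C S B" "samp B' \<cdot>\<^bsub>C\<^esub> p \<in> Hom C S B'"
      using Comp_in_Hom samp_in_Hom[OF P] q p o by (auto simp: Hom_det_cat)
    have "?F n \<cdot>\<^bsub>C\<^esub> p \<in> Hom (det_cat C) S (P D)"
      using F.source.Comp_in_Hom[OF p F.maps_Hom[OF n]] by simp
    then have "m \<cdot>\<^bsub>C\<^esub> samp B \<cdot>\<^bsub>C\<^esub> q = n \<cdot>\<^bsub>C\<^esub> samp B' \<cdot>\<^bsub>C\<^esub> p"
      using dist_map_samp_eq[OF P _ q] dist_map_samp_eq[OF P _ p] t eq by metis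
    then obtain r where r: "r \<in> Hom C S A"
      and fr: "f \<cdot>\<^bsub>C\<^esub> r = samp B \<cdot>\<^bsub>C\<^esub> q" and gr: "g \<cdot>\<^bsub>C\<^esub> r = samp B' \<cdot>\<^bsub>C\<^esub> p"
      using weak_pullback_lift[OF assms(3,4) wpb _ _ fl] t Hom_D by metis
    note r' = sharp[OF P r]
    show ?thesis
    proof (intro bexI conjI)
      show "?F f \<cdot>\<^bsub>C\<^esub> sharp C P samp r = q"
        using dist_map_samp_eq[OF P _ r'(1) q] t r'(2) fr by simp
      show "?F g \<cdot>\<^bsub>C\<^esub> sharp C P samp r = p"
        using dist_map_samp_eq[OF P _ r'(1) p] t r'(2) gr by simp
    qed (rule r'(1))
  qed
  ultimately show "weak_pullback (det_cat C) (?F f) (?F g) (?F m) (?F n)"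
    unfolding weak_pullback_def det_cat_simps
    using F.maps_Hom[OF f] F.maps_Hom[OF g] F.maps_Hom[OF m] F.maps_Hom[OF n]
    by - (rule exI[of _ "P A"], rule exI[of _ "P B"], rule exI[of _ "P B'"], rule exI[of _ "P D"], blast)
qed

end
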